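(* Let $k$ be a $\sigma\delta$-field of characteristic $0$ on which $\sigma\delta=\delta\sigma$. Let $A\in GL_m(k)$, let $X$ be an $m\times m$ matrix of differential indeterminates over $k$, and consider the field $L=k\langle X,\det(X)^{-1}\rangle$, on which the automorphism is extended by setting $\sigma(X)=AX$ and requiring that $\sigma$ and $\delta$ commute. Suppose that $D_k=C_k$, i.e. that the field $C_k$ of $\sigma$-constants of $k$ is relatively algebraically closed in $k$. Then the ring $kC_L\{X,\det(X)^{-1}\}$ is a Picard-Vessiot extension over $kC_L$ for the equation $\sigma(X)=AX$, and it is a simple $\sigma$-ring.
   Context: A $\sigma\delta$-field (ring) is a field (ring) with an automorphism $\sigma$ and a derivation $\delta$ (commuting with each other). For a field or ring $F$ with automorphism $\sigma$, $C_F=\{x\in F:\sigma(x)=x\}$ is the field/ring of $\sigma$-constants, and for a field $F$, $D_F=C_F^{a}\cap F$ is the relative algebraic closure of $C_F$ in $F$. $F\{a\}$ and $F\langle a\rangle$ denote respectively the $\delta$-differential ring and the $\delta$-differential field generated over $F$ by $a$; thus $L=k(X,X',X'',\dots)$ with all entries of $X,X',X'',\dots$ algebraically independent over $k$, and $\sigma(X^{(j)})=\sum_{i=0}^{j}\binom{j}{i}A^{(i)}X^{(j-i)}$. $kC_L$ is the subfield of $L$ generated by $k$ and $C_L$. A $\sigma$-ideal (resp. $\sigma\delta$-ideal) is an ideal stable under $\sigma$ (resp. $\sigma$ and $\delta$); a $\sigma$-ring (resp. $\sigma\delta$-ring) is simple if its only $\sigma$-ideals (resp. $\sigma\delta$-ideals)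 are $0$ and the whole ring. For a $\sigma\delta$-field $F$ and $A\in GL_m(F)$, a Picard-Vessiot extension over $F$ for $\sigma(X)=AX$ is a simple $\sigma\delta$-ring $P\supseteq F$ (with operators extending those of $F$) such that $P=F\{Z,\det(Z)^{-1}\}$ for some fundamental matrix $Z\in GL_m(P)$ with $\sigma(Z)=AZ$. *)

theory Defs
  imports
    "HOL-Analysis.Analysis"
    "HOL-Computational_Algebra.Polynomial"
    "HOL-Library.Poly_Mapping"
begin

text \<open>
  Rings and fields are subsets of an ambient type of class \<open>comm_ring_1\<close>, and an automorphism or a
  derivation of such a subset is a function on the ambient type of which only the values on the
  subset matter.  In this way operators on an extension automatically extend the given ones.
\<close>

definition is_subring :: "'a::comm_ring_1 set \<Rightarrow> bool" where
  "is_subring R \<longleftrightarrow> 0 \<in> R \<and> 1 \<in> R \<and>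
     (\<forall>x\<in>R. \<forall>y\<in>R. x + y \<in> R \<and> x * y \<in> R) \<and> (\<forall>x\<in>R. - x \<in> R)"

definition is_subfield :: "'a::comm_ring_1 set \<Rightarrow> bool" where
  "is_subfield F \<longleftrightarrow> is_subring F \<and> (\<forall>x\<in>F. x \<noteq> 0 \<longrightarrow> (\<exists>y\<in>F. x * y = 1))"

definition automorphism_of :: "'a::comm_ring_1 set \<Rightarrow> ('a \<Rightarrow> 'a) \<Rightarrow> bool" where
  "automorphism_of R \<sigma> \<longleftrightarrow> bij_betw \<sigma> R R \<and> \<sigma> 1 = 1 \<and>
     (\<forall>x\<in>R. \<forall>y\<in>R. \<sigma> (x + y) = \<sigma> x + \<sigma> y \<and> \<sigma> (x * y) = \<sigma> x * \<sigma> y)"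

definition derivation_of :: "'a::comm_ring_1 set \<Rightarrow> ('a \<Rightarrow> 'a) \<Rightarrow> bool" where
  "derivation_of R \<delta> \<longleftrightarrow> \<delta> ` R \<subseteq> R \<and>
     (\<forall>x\<in>R. \<forall>y\<in>R. \<delta> (x + y) = \<delta> x + \<delta> y \<and> \<delta> (x * y) = \<delta> x * y + x * \<delta> y)"

definition sigma_ring :: "('a::comm_ring_1 \<Rightarrow> 'a) \<Rightarrow> 'a set \<Rightarrow> bool" where
  "sigma_ring \<sigma> R \<longleftrightarrow> is_subring R \<and> automorphism_of R \<sigma>"

definition sigma_delta_ring :: "('a::comm_ring_1 \<Rightarrow> 'a) \<Rightarrow> ('a \<Rightarrow> 'a) \<Rightarrow> 'a set \<Rightarrow> bool" where
  "sigma_delta_ring \<sigma> \<delta> R \<longleftrightarrow> is_subring R \<and> automorphism_of R \<sigma> \<and> derivation_of R \<delta> \<and>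
     (\<forall>x\<in>R. \<sigma> (\<delta> x) = \<delta> (\<sigma> x))"

definition sigma_delta_field :: "('a::comm_ring_1 \<Rightarrow> 'a) \<Rightarrow> ('a \<Rightarrow> 'a) \<Rightarrow> 'a set \<Rightarrow> bool" where
  "sigma_delta_field \<sigma> \<delta> F \<longleftrightarrow> is_subfield F \<and> sigma_delta_ring \<sigma> \<delta> F"

definition sigma_constants :: "('a \<Rightarrow> 'a) \<Rightarrow> 'a set \<Rightarrow> 'a set" where
  "sigma_constants \<sigma> F = {x \<in> F. \<sigma> x = x}"

definition algebraic_over :: "'a::comm_ring_1 set \<Rightarrow> 'a \<Rightarrow> bool" where
  "algebraic_over C x \<longleftrightarrow> (\<exists>p. p \<noteq> 0 \<and> (\<forall>i. coeff p i \<in> C) \<and> poly p x = 0)"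

text \<open>\<open>D\<^sub>F\<close>, the relative algebraic closure of \<open>C\<^sub>F\<close> in \<open>F\<close>.\<close>

definition rel_alg_closure_constants :: "('a::comm_ring_1 \<Rightarrow> 'a) \<Rightarrow> 'a set \<Rightarrow> 'a set" where
  "rel_alg_closure_constants \<sigma> F = {x \<in> F. algebraic_over (sigma_constants \<sigma> F) x}"

text \<open>
  \<open>F{S}\<close> and \<open>F\<langle>S\<rangle>\<close>.  The hulls are intersections; since inverses are unique, an intersection of
  subfields is a subfield.
\<close>

definition delta_ring_gen :: "('a::comm_ring_1 \<Rightarrow> 'a) \<Rightarrow> 'a set \<Rightarrow> 'a set \<Rightarrow> 'a set" where
  "delta_ring_gen \<delta> F S = (\<lambda>R. is_subring R \<and> \<delta> ` R \<subseteq> R) hull (F \<union> S)"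

definition delta_field_gen :: "('a::comm_ring_1 \<Rightarrow> 'a) \<Rightarrow> 'a set \<Rightarrow> 'a set \<Rightarrow> 'a set" where
  "delta_field_gen \<delta> F S = (\<lambda>R. is_subfield R \<and> \<delta> ` R \<subseteq> R) hull (F \<union> S)"

text \<open>
  \<open>(('v \<Rightarrow>\<^sub>0 nat) \<Rightarrow>\<^sub>0 'a)\<close> represents polynomials in the variables \<open>'v\<close>, the inner mapping being the
  exponent vector of a monomial.
\<close>

definition mpoly_eval :: "('v \<Rightarrow> 'a::comm_ring_1) \<Rightarrow> (('v \<Rightarrow>\<^sub>0 nat) \<Rightarrow>\<^sub>0 'a) \<Rightarrow> 'a" where
  "mpoly_eval x p = (\<Sum>t\<in>Poly_Mapping.keys p.
     Poly_Mapping.lookup p t * (\<Prod>v\<in>Poly_Mapping.keys t. x v ^ Poly_Mapping.lookup t v))"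

definition alg_independent_over :: "'a::comm_ring_1 set \<Rightarrow> ('v \<Rightarrow> 'a) \<Rightarrow> bool" where
  "alg_independent_over K x \<longleftrightarrow>
     (\<forall>p. (\<forall>t. Poly_Mapping.lookup p t \<in> K) \<longrightarrow> mpoly_eval x p = 0 \<longrightarrow> p = 0)"

definition mat_entries :: "'a^'m^'m \<Rightarrow> 'a set" where
  "mat_entries Z = {Z $ i $ j | i j. True}"

definition differential_indeterminates ::
    "('a::comm_ring_1 \<Rightarrow> 'a) \<Rightarrow> 'a set \<Rightarrow> 'a^'m^'m \<Rightarrow> bool" where
  "differential_indeterminates \<delta> K X \<longleftrightarrow>
     alg_independent_over K (\<lambda>(i, j, n). (\<delta> ^^ n) (X $ i $ j))"

definition GL_over :: "'a::comm_ring_1 set \<Rightarrow> ('a^'m^'m) set" where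
  "GL_over R = {Z. mat_entries Z \<subseteq> R \<and>
     (\<exists>W. mat_entries W \<subseteq> R \<and> Z ** W = mat 1 \<and> W ** Z = mat 1)}"

definition ideal_of :: "'a::comm_ring_1 set \<Rightarrow> 'a set \<Rightarrow> bool" where
  "ideal_of R I \<longleftrightarrow> I \<subseteq> R \<and> 0 \<in> I \<and> (\<forall>x\<in>I. \<forall>y\<in>I. x + y \<in> I) \<and> (\<forall>r\<in>R. \<forall>x\<in>I. r * x \<in> I)"

definition simple_sigma_ring :: "('a::comm_ring_1 \<Rightarrow> 'a) \<Rightarrow> 'a set \<Rightarrow> bool" where
  "simple_sigma_ring \<sigma> R \<longleftrightarrow> sigma_ring \<sigma> R \<and>
     (\<forall>I. ideal_of R I \<and> \<sigma> ` I \<subseteq> I \<longrightarrow> I = {0} \<or> I = R)"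

definition simple_sigma_delta_ring :: "('a::comm_ring_1 \<Rightarrow> 'a) \<Rightarrow> ('a \<Rightarrow> 'a) \<Rightarrow> 'a set \<Rightarrow> bool" where
  "simple_sigma_delta_ring \<sigma> \<delta> R \<longleftrightarrow> sigma_delta_ring \<sigma> \<delta> R \<and>
     (\<forall>I. ideal_of R I \<and> \<sigma> ` I \<subseteq> I \<and> \<delta> ` I \<subseteq> I \<longrightarrow> I = {0} \<or> I = R)"

text \<open>
  \<open>P\<close> is a Picard-Vessiot extension over \<open>F\<close> for \<open>\<sigma>(X) = A X\<close>.  It need not be a domain, so the
  inverse \<open>d\<close> of \<open>det Z\<close> is named explicitly.
\<close>

definition picard_vessiot_extension ::
    "('a::comm_ring_1 \<Rightarrow> 'a) \<Rightarrow> ('a \<Rightarrow> 'a) \<Rightarrow> 'a set \<Rightarrow> 'a^'m^'m \<Rightarrow> 'a set \<Rightarrow> bool" where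
  "picard_vessiot_extension \<sigma> \<delta> F A P \<longleftrightarrow>
     sigma_delta_field \<sigma> \<delta> F \<and> A \<in> GL_over F \<and> F \<subseteq> P \<and> simple_sigma_delta_ring \<sigma> \<delta> P \<and>
     (\<exists>Z\<in>GL_over P. map_matrix \<sigma> Z = A ** Z \<and>
        (\<exists>d\<in>P. det Z * d = 1 \<and> P = delta_ring_gen \<delta> F (mat_entries Z \<union> {d})))"

end

theory Submission
  imports Defs
begin

text \<open>
  Let \<open>F = kC\<^sub>L\<close> and \<open>R = F{X, det(X)\<^sup>-\<^sup>1}\<close>, a subring of the field \<open>L\<close>.  In \<open>R \<otimes>\<^sub>F R\<close> the matrix
  \<open>(X\<^sup>-\<^sup>1 \<otimes> 1)(1 \<otimes> X)\<close> is \<open>\<sigma>\<close>-constant, so \<open>R \<otimes>\<^sub>F R = (R \<otimes> 1) D\<close> where \<open>D\<close> is the ring of its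
  \<open>\<sigma>\<close>-constants.  Let \<open>h \<noteq> 0\<close> lie in a \<open>\<sigma>\<close>-ideal \<open>I\<close>.  By descent along \<open>\<sigma>\<close>, the element \<open>1 \<otimes> h\<close> is an
  \<open>R \<otimes> 1\<close>-combination of constants lying in \<open>R \<otimes> I\<close>.  Exchanging the two factors and rewriting \<open>1 \<otimes> R\<close>
  in terms of \<open>R \<otimes> 1\<close> and \<open>D\<close>, the element \<open>h \<otimes> 1\<close> becomes an \<open>R \<otimes> 1\<close>-combination of constants lying
  in \<open>I \<otimes> R\<close>.  As \<open>h\<close> is invertible in \<open>L\<close>, descent along \<open>\<sigma>\<close> puts \<open>e \<otimes> 1\<close> in \<open>I \<otimes> R\<close> for some constant
  \<open>e \<noteq> 0\<close>, which forces \<open>1 \<in> I\<close> because \<open>e \<in> F\<close>.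
\<close>

subsection \<open>Subrings, subfields and endomorphisms\<close>

lemma is_subringD:
  assumes "is_subring R"
  shows "0 \<in> R" "1 \<in> R" "x \<in> R \<Longrightarrow> y \<in> R \<Longrightarrow> x + y \<in> R" "x \<in> R \<Longrightarrow> y \<in> R \<Longrightarrow> x * y \<in> R"
    "x \<in> R \<Longrightarrow> - x \<in> R" "x \<in> R \<Longrightarrow> y \<in> R \<Longrightarrow> x - y \<in> R"
proof -
  show "x \<in> R \<Longrightarrow> y \<in> R \<Longrightarrow> x - y \<in> R"
    using assms by (metis is_subring_def diff_conv_add_uminus)
qed (use assms in \<open>auto simp: is_subring_def\<close>)

lemma is_subfield_inverse:
  fixes F :: "'a::field set"
  assumes "is_subfield F" "x \<in> F"
  shows "inverse x \<in> F"
  using assms by (cases "x = 0") (auto simp: is_subfield_def is_subring_def dest: inverse_unique)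

lemma is_subring_sum: "is_subring R \<Longrightarrow> (\<And>i. i \<in> S \<Longrightarrow> f i \<in> R) \<Longrightarrow> (\<Sum>i\<in>S. f i) \<in> R"
  by (induction S rule: infinite_finite_induct) (auto simp: is_subringD)

lemma is_subring_prod: "is_subring R \<Longrightarrow> (\<And>i. i \<in> S \<Longrightarrow> f i \<in> R) \<Longrightarrow> (\<Prod>i\<in>S. f i) \<in> R"
  by (induction S rule: infinite_finite_induct) (auto simp: is_subringD)

lemma is_subring_det:
  fixes M :: "'a::comm_ring_1^'b^'b"
  assumes "is_subring R" "\<And>i j. M $ i $ j \<in> R"
  shows "det M \<in> R"
proof -
  have "of_int (sign p) \<in> R" for p :: "'b \<Rightarrow> 'b"
    using is_subringD(2,5)[OF assms(1)] by (auto simp: sign_def)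
  then show ?thesis
    unfolding det_def using assms by (intro is_subring_sum is_subringD(4) is_subring_prod)
qed

lemma is_subring_matrix_mult:
  assumes "is_subring R" "\<And>i j. M $ i $ j \<in> R" "\<And>i j. N $ i $ j \<in> R"
  shows "(M ** N) $ i $ j \<in> R"
proof -
  have "(\<Sum>l\<in>UNIV. M $ i $ l * N $ l $ j) \<in> R"
    using assms by (intro is_subring_sum is_subringD(4)[OF assms(1)])
  then show ?thesis by (simp add: matrix_matrix_mult_def)
qed

text \<open>By Cramer's rule each entry of the inverse is a determinant over \<open>R\<close>
  divided by \<open>det M\<close>. Hence adjoining \<open>inverse (det X)\<close> makes
  \<open>X\<close> invertible over the generated ring.\<close>

lemma is_subring_matrix_inverse:
  fixes M W :: "'a::field^'m^'m"
  assumes R: "is_subring R" and M: "\<And>i j. M $ i $ j \<in> R" and "inverse (det M) \<in> R"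
    and "M ** W = mat 1"
  shows "W $ i $ j \<in> R"
proof -
  have "det M * det W = 1"
    using assms(4) by (metis det_mul det_I)
  then have "det M \<noteq> 0" by auto
  have "M *v column j W = column j (mat 1)"
    using assms(4) by (simp add: vec_eq_iff matrix_vector_mult_def column_def matrix_matrix_mult_def)
  then have "column j W = (\<chi> k. det (\<chi> i l. if l = k then column j (mat 1) $ i else M $ i $ l) / det M)"
    using cramer[OF \<open>det M \<noteq> 0\<close>] by blast
  then have "W $ i $ j = det (\<chi> i' l. if l = i then column j (mat 1) $ i' else M $ i' $ l) * inverse (det M)"
    by (simp add: vec_eq_iff column_def divide_inverse)
  moreover have "det (\<chi> i' l. if l = i then column j (mat 1) $ i' else M $ i' $ l) \<in> R"
    using M is_subringD[OF R] by (intro is_subring_det[OF R]) (auto simp: column_def mat_def)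
  ultimately show ?thesis
    using assms(3) is_subringD(4)[OF R] by simp
qed

lemma is_subfieldI:
  fixes F :: "'a::field set"
  assumes "is_subring F" "\<And>x. x \<in> F \<Longrightarrow> x \<noteq> 0 \<Longrightarrow> inverse x \<in> F"
  shows "is_subfield F"
proof -
  have "\<exists>y\<in>F. x * y = 1" if "x \<in> F" "x \<noteq> 0" for x
    using assms(2)[OF that] that(2) by (intro bexI[of _ "inverse x"]) auto
  then show ?thesis using assms(1) by (simp add: is_subfield_def)
qed

lemma is_subfield_Inter:
  fixes \<F> :: "'a::field set set"
  assumes "\<And>F. F \<in> \<F> \<Longrightarrow> is_subfield F"
  shows "is_subfield (\<Inter>\<F>)"
proof (rule is_subfieldI)
  show "inverse x \<in> \<Inter>\<F>" if "x \<in> \<Inter>\<F>" for x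
    using that assms is_subfield_inverse by blast
  show "is_subring (\<Inter>\<F>)"
    using assms unfolding is_subfield_def is_subring_def by blast
qed

lemma delta_ring_gen_props:
  shows "is_subring (delta_ring_gen \<delta> F S)" "\<delta> ` delta_ring_gen \<delta> F S \<subseteq> delta_ring_gen \<delta> F S"
    "F \<subseteq> delta_ring_gen \<delta> F S" "S \<subseteq> delta_ring_gen \<delta> F S"
proof -
  let ?p = "\<lambda>R. is_subring R \<and> \<delta> ` R \<subseteq> R"
  have "?p (\<Inter>\<R>)" if \<R>: "Ball \<R> ?p" for \<R>
  proof -
    have "is_subring R" "x \<in> R \<Longrightarrow> \<delta> x \<in> R" if "R \<in> \<R>" for R x
      using that \<R> by auto
    then show ?thesis
      by (auto simp: is_subring_def)
  qed
  then have "?p (?p hull (F \<union> S))"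
    by (rule hull_in[where S = ?p])
  then show "is_subring (delta_ring_gen \<delta> F S)" "\<delta> ` delta_ring_gen \<delta> F S \<subseteq> delta_ring_gen \<delta> F S"
    by (simp_all add: delta_ring_gen_def)
  show "F \<subseteq> delta_ring_gen \<delta> F S" "S \<subseteq> delta_ring_gen \<delta> F S"
    using hull_subset[of "F \<union> S" ?p] by (simp_all add: delta_ring_gen_def)
qed

lemma delta_ring_gen_minimal:
  "is_subring R \<Longrightarrow> \<delta> ` R \<subseteq> R \<Longrightarrow> F \<subseteq> R \<Longrightarrow> S \<subseteq> R \<Longrightarrow> delta_ring_gen \<delta> F S \<subseteq> R"
  unfolding delta_ring_gen_def by (rule hull_minimal) auto

locale field_endomorphism =
  fixes \<sigma> :: "'a::field \<Rightarrow> 'a"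
  assumes hom_add: "\<sigma> (x + y) = \<sigma> x + \<sigma> y" and hom_mult: "\<sigma> (x * y) = \<sigma> x * \<sigma> y" and hom_1: "\<sigma> 1 = 1"
begin

lemma hom_0: "\<sigma> 0 = 0"
  using hom_add[of 0 0] by (metis add.right_neutral add_left_imp_eq)

lemma hom_uminus: "\<sigma> (- x) = - \<sigma> x"
  using hom_add[of x "- x"] hom_0 by (simp add: eq_neg_iff_add_eq_0 add.commute)

lemma hom_inverse: "\<sigma> (inverse x) = inverse (\<sigma> x)"
proof (cases "x = 0")
  case False
  then have "\<sigma> x * \<sigma> (inverse x) = 1"
    using hom_1 by (simp flip: hom_mult)
  then show ?thesis by (simp add: inverse_unique)
qed (simp add: hom_0)

lemma hom_sum: "\<sigma> (\<Sum>i\<in>S. f i) = (\<Sum>i\<in>S. \<sigma> (f i))"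
  by (induction S rule: infinite_finite_induct) (auto simp: hom_0 hom_add)

lemma hom_prod: "\<sigma> (\<Prod>i\<in>S. f i) = (\<Prod>i\<in>S. \<sigma> (f i))"
  by (induction S rule: infinite_finite_induct) (auto simp: hom_1 hom_mult)

lemma hom_det: "\<sigma> (det M) = det (map_matrix \<sigma> M)"
  by (auto simp: det_def map_matrix_def hom_sum hom_prod hom_mult hom_1 hom_uminus sign_def intro!: sum.cong)

lemma hom_matrix_mult: "map_matrix \<sigma> (M ** N) = map_matrix \<sigma> M ** map_matrix \<sigma> N"
  by (simp add: map_matrix_def matrix_matrix_mult_def hom_sum hom_mult vec_eq_iff)

lemma hom_mat_1: "map_matrix \<sigma> (mat 1) = mat 1"
  by (simp add: map_matrix_def mat_def hom_0 hom_1 vec_eq_iff)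

lemma is_subring_vimage: "is_subring R \<Longrightarrow> is_subring {x. \<sigma> x \<in> R}"
  by (auto simp: is_subring_def hom_0 hom_1 hom_add hom_mult hom_uminus)

lemma is_subfield_vimage: "is_subfield F \<Longrightarrow> is_subfield {x. \<sigma> x \<in> F}"
  by (intro is_subfieldI) (auto simp: is_subfield_def hom_inverse
    intro: is_subring_vimage is_subfield_inverse[unfolded is_subfield_def])

text \<open>As \<open>\<sigma>\<close> commutes with \<open>\<delta>\<close>, the preimage of the
  generated ring under \<open>\<sigma>\<close> is again a \<open>\<delta>\<close>-stable subring
  containing \<open>F\<close> and \<open>S\<close>, so minimality applies.\<close>

lemma delta_ring_gen_stable:
  assumes "\<And>x. \<sigma> (\<delta> x) = \<delta> (\<sigma> x)" "\<sigma> ` F \<subseteq> F" "\<sigma> ` S \<subseteq> delta_ring_gen \<delta> F S"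
  shows "\<sigma> ` delta_ring_gen \<delta> F S \<subseteq> delta_ring_gen \<delta> F S"
proof -
  note props = delta_ring_gen_props[where \<delta> = \<delta> and F = F and S = S]
  have "delta_ring_gen \<delta> F S \<subseteq> {x. \<sigma> x \<in> delta_ring_gen \<delta> F S}"
    using assms props by (intro delta_ring_gen_minimal is_subring_vimage) auto
  then show ?thesis by auto
qed

end

subsection \<open>Descent along an endomorphism\<close>

text \<open>
  Galois descent for \<open>\<sigma>\<close>: a \<open>\<sigma>\<close>-stable subspace has a basis of constant vectors in reduced
  echelon form, and the coefficients of a vector with respect to it are among its coordinates.
  A vector with pivot \<open>1\<close> and minimal support is constant, since \<open>\<sigma> u - u\<close> has smaller support.
\<close>

lemma constant_vectors_span:
  fixes \<Lambda> :: "('i \<Rightarrow> 'a::field) set"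
  assumes "finite S"
    and supp: "\<And>v i. v \<in> \<Lambda> \<Longrightarrow> i \<notin> S \<Longrightarrow> v i = 0"
    and add: "\<And>v w. v \<in> \<Lambda> \<Longrightarrow> w \<in> \<Lambda> \<Longrightarrow> (\<lambda>i. v i + w i) \<in> \<Lambda>"
    and scale: "\<And>c v. v \<in> \<Lambda> \<Longrightarrow> (\<lambda>i. c * v i) \<in> \<Lambda>"
    and \<sigma>: "\<And>v. v \<in> \<Lambda> \<Longrightarrow> (\<lambda>i. \<sigma> (v i)) \<in> \<Lambda>"
    and \<sigma>_0: "\<sigma> 0 = 0" and \<sigma>_1: "\<sigma> 1 = 1"
    and R: "is_subring R" and const: "\<And>x. \<sigma> x = x \<Longrightarrow> x \<in> R"
    and P_0: "P (\<lambda>_. 0)" and P_add: "\<And>v w. P v \<Longrightarrow> P w \<Longrightarrow> P (\<lambda>i. v i + w i)"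
    and P_gen: "\<And>\<rho> e. \<rho> \<in> R \<Longrightarrow> e \<in> \<Lambda> \<Longrightarrow> (\<And>i. \<sigma> (e i) = e i) \<Longrightarrow> P (\<lambda>i. \<rho> * e i)"
    and r: "r \<in> \<Lambda>" "\<And>i. r i \<in> R"
  shows "P r"
  using assms(1) supp add scale \<sigma> P_gen r
proof (induction S arbitrary: \<Lambda> r rule: finite_induct)
  case empty
  then have "r = (\<lambda>_. 0)" by auto
  then show ?case using P_0 by simp
next
  case (insert s S)
  \<comment> \<open>The induction eliminates the coordinate \<open>s\<close>:
    \<open>\<Lambda>'\<close> is the subspace supported on \<open>S\<close>.\<close>
  define \<Lambda>' where "\<Lambda>' = {v \<in> \<Lambda>. v s = 0}"
  have IH: "P v" if "v \<in> \<Lambda>'" "\<And>i. v i \<in> R" for v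
  proof (rule insert.IH[of \<Lambda>'])
    show "w i = 0" if "w \<in> \<Lambda>'" "i \<notin> S" for w i
      using insert.prems(1)[of w i] that by (cases "i = s") (auto simp: \<Lambda>'_def)
  qed (use insert.prems that \<sigma>_0 in \<open>auto simp: \<Lambda>'_def\<close>)
  show ?case
  proof (cases "\<exists>u\<in>\<Lambda>. u s \<noteq> 0")
    case False
    then show ?thesis
      using insert.prems by (intro IH) (auto simp: \<Lambda>'_def)
  next
    case True
    then obtain u0 where "u0 \<in> \<Lambda>" "u0 s \<noteq> 0" by auto
    then have "(\<lambda>i. inverse (u0 s) * u0 i) \<in> \<Lambda> \<and> inverse (u0 s) * u0 s = 1"
      using insert.prems(3) by auto
    from ex_has_least_nat[of "\<lambda>u. u \<in> \<Lambda> \<and> u s = 1", OF this, of "\<lambda>u. card {i. u i \<noteq> 0}"]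
    obtain u where u: "u \<in> \<Lambda>" "u s = 1"
      and least: "\<And>w. w \<in> \<Lambda> \<Longrightarrow> w s = 1 \<Longrightarrow> card {i. u i \<noteq> 0} \<le> card {i. w i \<noteq> 0}"
      by auto
    have diff: "(\<lambda>i. v i - c * w i) \<in> \<Lambda>" if "v \<in> \<Lambda>" "w \<in> \<Lambda>" for v w c
      using insert.prems(2)[OF that(1) insert.prems(3)[OF that(2), of "- c"]] by simp
    have u_const: "\<sigma> (u i) = u i" for i
    proof (rule ccontr)
      assume "\<sigma> (u i) \<noteq> u i"
      \<comment> \<open>\<open>v\<close> vanishes at \<open>s\<close> and wherever \<open>u\<close>
        does, so subtracting a suitable multiple of it from \<open>u\<close> kills coordinate
        \<open>i\<close> and keeps the pivot. The factor \<open>1\<close> matches the shape of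
        \<open>diff\<close>.\<close>
      define v where "v = (\<lambda>j. \<sigma> (u j) - 1 * u j)"
      define w where "w = (\<lambda>j. u j - (u i / v i) * v j)"
      have "v \<in> \<Lambda>" unfolding v_def by (rule diff) (use u insert.prems(4) in auto)
      then have "w \<in> \<Lambda>" unfolding w_def by (rule diff[OF u(1)])
      moreover have "w s = 1" using u \<sigma>_1 by (simp add: w_def v_def)
      moreover have "{j. w j \<noteq> 0} \<subset> {j. u j \<noteq> 0}"
      proof -
        have "v i \<noteq> 0" using \<open>\<sigma> (u i) \<noteq> u i\<close> by (simp add: v_def)
        then have "w i = 0" by (simp add: w_def)
        moreover have "u i \<noteq> 0" using \<open>\<sigma> (u i) \<noteq> u i\<close> \<sigma>_0 by auto
        moreover have "w j = 0" if "u j = 0" for j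
          using that \<sigma>_0 by (simp add: w_def v_def)
        ultimately show ?thesis by auto
      qed
      moreover have "finite {j. u j \<noteq> 0}"
        by (rule finite_subset[of _ "insert s S"]) (use insert.prems(1)[OF u(1)] insert.hyps in auto)
      ultimately show False
        using least[of w] by (metis psubset_card_mono not_less)
    qed
    \<comment> \<open>One elimination step with pivot \<open>s\<close>. The entries of
      \<open>u\<close> are constant, hence in \<open>R\<close>, so the reduced vector still has
      coordinates in \<open>R\<close>.\<close>
    have "(\<lambda>i. r i - r s * u i) \<in> \<Lambda>'"
      using diff insert.prems(6) u by (auto simp: \<Lambda>'_def)
    moreover have "r i - r s * u i \<in> R" for i
      by (intro is_subringD[OF R] insert.prems(7) const u_const)
    ultimately have "P (\<lambda>i. r i - r s * u i)"
      by (intro IH)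
    moreover have "P (\<lambda>i. r s * u i)"
      using insert.prems u u_const by auto
    ultimately have "P (\<lambda>i. (r i - r s * u i) + r s * u i)"
      by (rule P_add)
    then show ?thesis by simp
  qed
qed

text \<open>A maximal \<open>F\<close>-subspace \<open>M\<close> containing \<open>I\<close> but not
  \<open>1\<close> is a complement of \<open>F\<close>, and \<open>\<phi>\<close> is the projection
  onto \<open>F\<close> along \<open>M\<close>. It will separate \<open>e \<otimes> 1\<close> from
  \<open>I \<otimes> L\<close> for nonzero \<open>e\<close> in \<open>F\<close>.\<close>

lemma subspace_functional:
  fixes F :: "'a::field set"
  assumes F: "is_subfield F"
    and I: "0 \<in> I" "\<And>x y. x \<in> I \<Longrightarrow> y \<in> I \<Longrightarrow> x + y \<in> I" "\<And>f x. f \<in> F \<Longrightarrow> x \<in> I \<Longrightarrow> f * x \<in> I"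
    and "1 \<notin> I"
  obtains \<phi> where "\<And>x y. \<phi> (x + y) = \<phi> x + \<phi> y" "\<And>f x. f \<in> F \<Longrightarrow> \<phi> (f * x) = f * \<phi> x"
    "\<And>x. x \<in> I \<Longrightarrow> \<phi> x = 0" "\<phi> 1 = 1"
proof -
  have "is_subring F" using F by (simp add: is_subfield_def)
  note F_ring = is_subringD[OF this]
  define \<M> where "\<M> = {M. I \<subseteq> M \<and> (\<forall>x\<in>M. \<forall>y\<in>M. x + y \<in> M) \<and> (\<forall>f\<in>F. \<forall>x\<in>M. f * x \<in> M) \<and> 1 \<notin> M}"
  have "\<exists>M\<in>\<M>. \<forall>N\<in>\<M>. M \<subseteq> N \<longrightarrow> N = M"
  proof (rule subset_Zorn_nonempty)
    have "I \<in> \<M>" unfolding \<M>_def using I \<open>1 \<notin> I\<close> by blast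
    then show "\<M> \<noteq> {}" by blast
  next
    fix \<C> assume "\<C> \<noteq> {}" and chain: "subset.chain \<M> \<C>"
    have \<C>: "I \<subseteq> M" "1 \<notin> M" if "M \<in> \<C>" for M
    proof -
      have "M \<in> \<M>" using that chain by (auto simp: subset_chain_def)
      then show "I \<subseteq> M" "1 \<notin> M" unfolding \<M>_def by blast+
    qed
    have "x + y \<in> \<Union>\<C>" if "x \<in> \<Union>\<C>" "y \<in> \<Union>\<C>" for x y
    proof -
      obtain M N where "M \<in> \<C>" "x \<in> M" "N \<in> \<C>" "y \<in> N" using \<open>x \<in> \<Union>\<C>\<close> \<open>y \<in> \<Union>\<C>\<close> by auto
      moreover then have "M \<subseteq> N \<or> N \<subseteq> M" "M \<in> \<M>" "N \<in> \<M>"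
        using chain by (auto simp: subset_chain_def)
      ultimately show ?thesis unfolding \<M>_def by blast
    qed
    moreover have "f * x \<in> \<Union>\<C>" if "f \<in> F" "x \<in> \<Union>\<C>" for f x
    proof -
      obtain M where "M \<in> \<C>" "x \<in> M" "M \<in> \<M>"
        using \<open>x \<in> \<Union>\<C>\<close> chain by (auto simp: subset_chain_def)
      then show ?thesis using \<open>f \<in> F\<close> unfolding \<M>_def by blast
    qed
    moreover have "I \<subseteq> \<Union>\<C>" "1 \<notin> \<Union>\<C>"
      using \<open>\<C> \<noteq> {}\<close> \<C> by blast+
    ultimately show "\<Union>\<C> \<in> \<M>"
      unfolding \<M>_def by blast
  qed
  then obtain M where "M \<in> \<M>" and max: "\<And>N. N \<in> \<M> \<Longrightarrow> M \<subseteq> N \<Longrightarrow> N = M" by auto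
  then have IM: "I \<subseteq> M" and M_add: "\<And>x y. x \<in> M \<Longrightarrow> y \<in> M \<Longrightarrow> x + y \<in> M"
    and M_scale: "\<And>f x. f \<in> F \<Longrightarrow> x \<in> M \<Longrightarrow> f * x \<in> M" and "1 \<notin> M"
    by (auto simp: \<M>_def)
  have M_diff: "x - y \<in> M" if "x \<in> M" "y \<in> M" for x y
    using M_add[OF that(1) M_scale[OF _ that(2), of "- 1"]] F_ring by simp
  have uniq: "f = g" if "f \<in> F" "g \<in> F" "x - f \<in> M" "x - g \<in> M" for f g x
  proof (rule ccontr)
    assume "f \<noteq> g"
    \<comment> \<open>This element equals \<open>1\<close>, because
      \<open>(x - f) - (x - g) = g - f\<close>.\<close>
    have "inverse (g - f) * ((x - f) - (x - g)) \<in> M"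
      using that by (intro M_scale M_diff[of "x - f" "x - g"] is_subfield_inverse[OF F] F_ring)
    then show False using \<open>f \<noteq> g\<close> \<open>1 \<notin> M\<close> by simp
  qed
  have ex: "\<exists>f\<in>F. x - f \<in> M" for x
  proof (cases "x \<in> M")
    case True
    then show ?thesis using F_ring(1) by (intro bexI[of _ 0]) auto
  next
    case False
    \<comment> \<open>\<open>N\<close> is \<open>M + F x\<close>. By maximality it contains
      \<open>1\<close>, and solving \<open>1 = m + f * x\<close> for \<open>x\<close> gives the
      residue \<open>inverse f\<close> modulo \<open>M\<close>.\<close>
    define N where "N = {m + f * x | m f. m \<in> M \<and> f \<in> F}"
    have "M \<subseteq> N"
    proof
      fix m assume "m \<in> M"
      then show "m \<in> N"
        unfolding N_def using F_ring(1) by (intro CollectI exI[of _ m] exI[of _ 0]) auto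
    qed
    have "0 + 1 * x \<in> N"
      unfolding N_def by (intro CollectI exI conjI, rule refl) (use F_ring IM I(1) in auto)
    then have "N \<noteq> M" using False by auto
    then have "N \<notin> \<M>" using max \<open>M \<subseteq> N\<close> by auto
    moreover have "y + z \<in> N" if yz: "y \<in> N" "z \<in> N" for y z
    proof -
      obtain m f m' f' where "y = m + f * x" "z = m' + f' * x" "m \<in> M" "f \<in> F" "m' \<in> M" "f' \<in> F"
        using yz unfolding N_def by blast
      moreover from this have "m + m' \<in> M" "f + f' \<in> F" using M_add F_ring(3) by auto
      moreover have "y + z = (m + m') + (f + f') * x"
        using \<open>y = _\<close> \<open>z = _\<close> by (simp add: algebra_simps)
      ultimately show ?thesis
        unfolding N_def by blast
    qed
    moreover have "g * y \<in> N" if gy: "g \<in> F" "y \<in> N" for g y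
    proof -
      obtain m f where "y = m + f * x" "m \<in> M" "f \<in> F"
        using gy unfolding N_def by blast
      moreover from this have "g * m \<in> M" "g * f \<in> F" using gy M_scale F_ring(4) by auto
      moreover have "g * y = g * m + (g * f) * x"
        using \<open>y = _\<close> by (simp add: algebra_simps)
      ultimately show ?thesis
        unfolding N_def by blast
    qed
    ultimately have "1 \<in> N"
      using IM \<open>M \<subseteq> N\<close> unfolding \<M>_def by blast
    then obtain m f where mf: "1 = m + f * x" "m \<in> M" "f \<in> F" by (auto simp: N_def)
    with \<open>1 \<notin> M\<close> have "f \<noteq> 0" by auto
    have "(- inverse f) * m \<in> M" using mf by (intro M_scale F_ring is_subfield_inverse[OF F])
    moreover have "(- inverse f) * m = x - inverse f"
      using mf(1) \<open>f \<noteq> 0\<close> by (simp add: field_simps)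
    ultimately show ?thesis using mf is_subfield_inverse[OF F] by auto
  qed
  define \<phi> where "\<phi> x = (SOME f. f \<in> F \<and> x - f \<in> M)" for x
  have \<phi>: "\<phi> x \<in> F" "x - \<phi> x \<in> M" for x
    using someI_ex[of "\<lambda>f. f \<in> F \<and> x - f \<in> M"] ex[of x] by (auto simp: \<phi>_def)
  have \<phi>_eq: "\<phi> x = f" if "f \<in> F" "x - f \<in> M" for x f
    using uniq \<phi> that by blast
  show thesis
  proof (rule that[of \<phi>])
    show "\<phi> (x + y) = \<phi> x + \<phi> y" for x y
      using M_add[OF \<phi>(2)[of x] \<phi>(2)[of y]] \<phi>(1) F_ring(3) by (intro \<phi>_eq) (auto simp: algebra_simps)
    show "\<phi> (f * x) = f * \<phi> x" if "f \<in> F" for f x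
      using M_scale[OF that \<phi>(2)[of x]] \<phi>(1) F_ring(4) that by (intro \<phi>_eq) (auto simp: algebra_simps)
    show "\<phi> x = 0" if "x \<in> I" for x
      using that IM F_ring(1) by (intro \<phi>_eq) auto
    show "\<phi> 1 = 1"
      using F_ring IM I(1) by (intro \<phi>_eq) auto
  qed
qed

subsection \<open>Formal tensors\<close>

text \<open>A separate type is used because pairs already carry componentwise addition, whereas here
  addition has to be the componentwise product.\<close>

datatype 'a pure_tensor = Ten (lft: 'a) (rgt: 'a)

instantiation pure_tensor :: (comm_monoid_mult) comm_monoid_add
begin

definition zero_pure_tensor :: "'a pure_tensor" where
  "0 = Ten 1 1"

definition plus_pure_tensor :: "'a pure_tensor \<Rightarrow> 'a pure_tensor \<Rightarrow> 'a pure_tensor" where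
  "p + q = Ten (lft p * lft q) (rgt p * rgt q)"

instance
  by standard (auto simp: zero_pure_tensor_def plus_pure_tensor_def mult_ac)

end

text \<open>
  A formal sum of pairs stands for an element of the tensor square of a field over a subfield \<open>F\<close>.
  These sums form the monoid ring of the multiplicative monoid of pairs (hence \<open>+\<close> on
  \<open>'a pure_tensor\<close> is multiplication); equality in the tensor product is congruence modulo the
  sums on which all \<open>F\<close>-balanced forms vanish, because a type cannot depend on \<open>F\<close>.
\<close>

type_synonym 'a tensor = "'a pure_tensor \<Rightarrow>\<^sub>0 int"

abbreviation pure :: "'a \<Rightarrow> 'a \<Rightarrow> 'a tensor" (infix "\<otimes>" 75) where
  "a \<otimes> b \<equiv> frag_of (Ten a b)"

lemma pure_mult: "a \<otimes> b * c \<otimes> d = (a * c) \<otimes> (b * d)"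
  for a b c d :: "'a::comm_monoid_mult"
  by (simp add: mult_single plus_pure_tensor_def)

lemma pure_one: "1 \<otimes> 1 = (1 :: 'a::comm_monoid_mult tensor)"
  by (simp flip: single_one add: zero_pure_tensor_def)

lemma tensor_induct [case_names zero pure diff]:
  assumes "P 0" "\<And>a b. P (a \<otimes> b)" "\<And>s t. P s \<Longrightarrow> P t \<Longrightarrow> P (s - t)"
  shows "P t"
proof (rule frag_induction[of t UNIV])
  show "P (frag_of p)" for p
    using assms(2) by (cases p) auto
qed (use assms in auto)

section \<open>Evaluation of forms on formal sums\<close>

definition eval_form :: "('a \<Rightarrow> 'a \<Rightarrow> 'a::comm_ring_1) \<Rightarrow> 'a tensor \<Rightarrow> 'a" where
  "eval_form \<beta> t = (\<Sum>p\<in>Poly_Mapping.keys t. of_int (Poly_Mapping.lookup t p) * \<beta> (lft p) (rgt p))"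

lemma eval_form_superset:
  assumes "finite S" "Poly_Mapping.keys t \<subseteq> S"
  shows "eval_form \<beta> t = (\<Sum>p\<in>S. of_int (Poly_Mapping.lookup t p) * \<beta> (lft p) (rgt p))"
  unfolding eval_form_def using assms by (intro sum.mono_neutral_left) (auto simp: in_keys_iff)

lemma eval_form_diff: "eval_form \<beta> (s - t) = eval_form \<beta> s - eval_form \<beta> t"
proof -
  let ?S = "Poly_Mapping.keys s \<union> Poly_Mapping.keys t"
  have "eval_form \<beta> (s - t) = (\<Sum>p\<in>?S. of_int (Poly_Mapping.lookup (s - t) p) * \<beta> (lft p) (rgt p))"
    by (rule eval_form_superset) (use keys_diff[of s t] in auto)
  also have "\<dots> = eval_form \<beta> s - eval_form \<beta> t"
    by (simp add: eval_form_superset[of ?S] lookup_minus sum_subtractf left_diff_distrib)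
  finally show ?thesis .
qed

lemma eval_form_0 [simp]: "eval_form \<beta> 0 = 0"
  by (simp add: eval_form_def)

lemma eval_form_uminus: "eval_form \<beta> (- t) = - eval_form \<beta> t"
  using eval_form_diff[of \<beta> 0 t] by simp

lemma eval_form_add: "eval_form \<beta> (s + t) = eval_form \<beta> s + eval_form \<beta> t"
  using eval_form_diff[of \<beta> s "- t"] by (simp add: eval_form_uminus)

lemma eval_form_sum: "eval_form \<beta> (\<Sum>i\<in>A. t i) = (\<Sum>i\<in>A. eval_form \<beta> (t i))"
  by (induction A rule: infinite_finite_induct) (auto simp: eval_form_add)

lemma eval_form_pure [simp]: "eval_form \<beta> (a \<otimes> b) = \<beta> a b"
  by (simp add: eval_form_def)

lemma eval_form_pure_mult:
  "eval_form \<beta> (c \<otimes> d * t) = eval_form (\<lambda>a b. \<beta> (c * a) (d * b)) t"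
  by (induction t rule: tensor_induct) (auto simp: eval_form_diff pure_mult right_diff_distrib)

text \<open>The annihilator of a set of forms. Equality in the tensor square and membership in its
  subspaces are both expressed by suitable choices of forms.\<close>

definition vanishing :: "('a \<Rightarrow> 'a \<Rightarrow> 'a::comm_ring_1) set \<Rightarrow> 'a tensor set" where
  "vanishing \<B> = {t. \<forall>\<beta>\<in>\<B>. eval_form \<beta> t = 0}"

lemma vanishing_0: "0 \<in> vanishing \<B>"
  and vanishing_add: "s \<in> vanishing \<B> \<Longrightarrow> t \<in> vanishing \<B> \<Longrightarrow> s + t \<in> vanishing \<B>"
  and vanishing_uminus: "t \<in> vanishing \<B> \<Longrightarrow> - t \<in> vanishing \<B>"
  and vanishing_diff: "s \<in> vanishing \<B> \<Longrightarrow> t \<in> vanishing \<B> \<Longrightarrow> s - t \<in> vanishing \<B>"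
  and vanishing_antimono: "\<B> \<subseteq> \<B>' \<Longrightarrow> vanishing \<B>' \<subseteq> vanishing \<B>"
  by (auto simp: vanishing_def eval_form_add eval_form_uminus eval_form_diff)

lemma vanishing_sum: "(\<And>i. i \<in> A \<Longrightarrow> t i \<in> vanishing \<B>) \<Longrightarrow> (\<Sum>i\<in>A. t i) \<in> vanishing \<B>"
  by (auto simp: vanishing_def eval_form_sum intro!: sum.neutral)

text \<open>Multiplication by \<open>c \<otimes> d\<close> translates both arguments of a form. Only
  the pairs occurring in \<open>s\<close> have to preserve \<open>\<B>\<close>; for
  \<open>left_annihilator\<close> this restricts \<open>s\<close> to left components in
  \<open>R\<close>.\<close>

lemma vanishing_mult:
  assumes "\<And>p \<beta>. p \<in> Poly_Mapping.keys s \<Longrightarrow> \<beta> \<in> \<B> \<Longrightarrow> (\<lambda>a b. \<beta> (lft p * a) (rgt p * b)) \<in> \<B>"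
    and "t \<in> vanishing \<B>"
  shows "s * t \<in> vanishing \<B>"
proof (rule frag_induction[of s "Poly_Mapping.keys s"])
  fix p assume "p \<in> Poly_Mapping.keys s"
  then have "lft p \<otimes> rgt p * t \<in> vanishing \<B>"
    using assms unfolding vanishing_def mem_Collect_eq eval_form_pure_mult by blast
  then show "frag_of p * t \<in> vanishing \<B>" by simp
qed (auto simp: vanishing_0 vanishing_diff left_diff_distrib)

section \<open>Endomorphism, derivation and exchange of factors\<close>

definition tensor_map :: "('a \<Rightarrow> 'a) \<Rightarrow> 'a tensor \<Rightarrow> 'a tensor" where
  "tensor_map \<sigma> = frag_extend (\<lambda>p. \<sigma> (lft p) \<otimes> \<sigma> (rgt p))"

definition tensor_deriv :: "('a \<Rightarrow> 'a) \<Rightarrow> 'a tensor \<Rightarrow> 'a tensor" where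
  "tensor_deriv \<delta> = frag_extend (\<lambda>p. \<delta> (lft p) \<otimes> rgt p + lft p \<otimes> \<delta> (rgt p))"

definition swap :: "'a tensor \<Rightarrow> 'a tensor" where
  "swap = frag_extend (\<lambda>p. rgt p \<otimes> lft p)"

lemmas tensor_op_defs = tensor_map_def tensor_deriv_def swap_def

lemma tensor_op_0 [simp]: "tensor_map \<sigma> 0 = 0" "tensor_deriv \<delta> 0 = 0" "swap 0 = 0"
  and tensor_op_add: "tensor_map \<sigma> (s + t) = tensor_map \<sigma> s + tensor_map \<sigma> t"
    "tensor_deriv \<delta> (s + t) = tensor_deriv \<delta> s + tensor_deriv \<delta> t" "swap (s + t) = swap s + swap t"
  and tensor_op_diff: "tensor_map \<sigma> (s - t) = tensor_map \<sigma> s - tensor_map \<sigma> t"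
    "tensor_deriv \<delta> (s - t) = tensor_deriv \<delta> s - tensor_deriv \<delta> t" "swap (s - t) = swap s - swap t"
  and tensor_op_pure [simp]: "tensor_map \<sigma> (a \<otimes> b) = \<sigma> a \<otimes> \<sigma> b"
    "tensor_deriv \<delta> (a \<otimes> b) = \<delta> a \<otimes> b + a \<otimes> \<delta> b" "swap (a \<otimes> b) = b \<otimes> a"
  by (simp_all add: tensor_op_defs frag_extend_add frag_extend_diff)

lemma tensor_map_sum: "tensor_map \<sigma> (\<Sum>i\<in>A. t i) = (\<Sum>i\<in>A. tensor_map \<sigma> (t i))"
  by (induction A rule: infinite_finite_induct) (auto simp: tensor_op_add)

lemma tensor_map_mult:
  fixes s t :: "'a::comm_monoid_mult tensor"
  assumes "\<And>x y. \<sigma> (x * y) = \<sigma> x * \<sigma> y"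
  shows "tensor_map \<sigma> (s * t) = tensor_map \<sigma> s * tensor_map \<sigma> t"
proof (induction s rule: tensor_induct)
  case (pure a b)
  show ?case
    by (induction t rule: tensor_induct)
      (auto simp: tensor_op_diff right_diff_distrib pure_mult assms)
qed (auto simp: tensor_op_diff left_diff_distrib)

lemma swap_mult:
  fixes s t :: "'a::comm_monoid_mult tensor"
  shows "swap (s * t) = swap s * swap t"
proof (induction s rule: tensor_induct)
  case (pure a b)
  show ?case
    by (induction t rule: tensor_induct)
      (auto simp: tensor_op_diff right_diff_distrib pure_mult)
qed (auto simp: tensor_op_diff left_diff_distrib)

lemma swap_tensor_map: "swap (tensor_map \<sigma> t) = tensor_map \<sigma> (swap t)"
  by (induction t rule: tensor_induct) (auto simp: tensor_op_diff)

lemma tensor_deriv_tensor_map: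
  assumes "\<And>x. \<sigma> (\<delta> x) = \<delta> (\<sigma> x)"
  shows "tensor_deriv \<delta> (tensor_map \<sigma> t) = tensor_map \<sigma> (tensor_deriv \<delta> t)"
  by (induction t rule: tensor_induct) (auto simp: tensor_op_diff tensor_op_add assms)

lemma eval_form_swap: "eval_form \<beta> (swap t) = eval_form (\<lambda>a b. \<beta> b a) t"
  by (induction t rule: tensor_induct) (auto simp: tensor_op_diff eval_form_diff)

lemma eval_form_tensor_map:
  "eval_form \<beta> (tensor_map \<sigma> t) = eval_form (\<lambda>a b. \<beta> (\<sigma> a) (\<sigma> b)) t"
  by (induction t rule: tensor_induct) (auto simp: tensor_op_diff eval_form_diff)

lemma eval_form_tensor_deriv:
  "eval_form \<beta> (tensor_deriv \<delta> t) = eval_form (\<lambda>a b. \<beta> (\<delta> a) b + \<beta> a (\<delta> b)) t"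
  by (induction t rule: tensor_induct) (auto simp: tensor_op_diff eval_form_diff eval_form_add)

text \<open>A condition on the representative: such sums stand for elements of
  \<open>R \<otimes> R\<close>, but a congruent sum need not satisfy it.\<close>

definition tensor_support :: "'a set \<Rightarrow> 'a tensor set" where
  "tensor_support R = {t. \<forall>p\<in>Poly_Mapping.keys t. lft p \<in> R \<and> rgt p \<in> R}"

lemma tensor_support_0: "0 \<in> tensor_support R"
  and tensor_support_add: "s \<in> tensor_support R \<Longrightarrow> t \<in> tensor_support R \<Longrightarrow> s + t \<in> tensor_support R"
  and tensor_support_pure: "a \<in> R \<Longrightarrow> b \<in> R \<Longrightarrow> a \<otimes> b \<in> tensor_support R"
  using keys_add[of s t] by (fastforce simp: tensor_support_def)+

lemma tensor_support_sum:
  "(\<And>i. i \<in> A \<Longrightarrow> t i \<in> tensor_support R) \<Longrightarrow> (\<Sum>i\<in>A. t i) \<in> tensor_support R"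
  by (induction A rule: infinite_finite_induct) (auto simp: tensor_support_0 tensor_support_add)

lemma tensor_support_mult:
  fixes R :: "'a::comm_ring_1 set"
  assumes "is_subring R" "s \<in> tensor_support R" "t \<in> tensor_support R"
  shows "s * t \<in> tensor_support R"
  using keys_mult[of s t] assms is_subringD(4)[OF assms(1)]
  by (fastforce simp: tensor_support_def plus_pure_tensor_def)

lemma tensor_support_swap: "t \<in> tensor_support R \<Longrightarrow> swap t \<in> tensor_support R"
  using keys_frag_extend[of "\<lambda>p. rgt p \<otimes> lft p" t]
  by (fastforce simp: tensor_support_def swap_def)

lemma tensor_support_tensor_deriv:
  assumes "\<delta> ` R \<subseteq> R" "t \<in> tensor_support R"
  shows "tensor_deriv \<delta> t \<in> tensor_support R"
proof -
  have "\<delta> (lft p) \<otimes> rgt p + lft p \<otimes> \<delta> (rgt p) \<in> tensor_support R" if "p \<in> Poly_Mapping.keys t" for p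
    using assms that by (intro tensor_support_add tensor_support_pure) (auto simp: tensor_support_def)
  then show ?thesis
    using keys_frag_extend[of "\<lambda>p. \<delta> (lft p) \<otimes> rgt p + lft p \<otimes> \<delta> (rgt p)" t]
    unfolding tensor_support_def tensor_deriv_def by blast
qed

text \<open>
  Forms are only balanced and biadditive, not bilinear: this class of forms is closed under
  composition with the semilinear map \<open>\<sigma>\<close> and with a derivation.
\<close>

definition balanced :: "'a set \<Rightarrow> ('a \<Rightarrow> 'a \<Rightarrow> 'a::comm_ring_1) set" where
  "balanced F = {\<beta>. (\<forall>a a' b. \<beta> (a + a') b = \<beta> a b + \<beta> a' b) \<and>
     (\<forall>a b b'. \<beta> a (b + b') = \<beta> a b + \<beta> a b') \<and> (\<forall>f\<in>F. \<forall>a b. \<beta> (f * a) b = \<beta> a (f * b))}"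

text \<open>
  For \<open>F\<close>-subspaces \<open>I\<close> the tensors killed by \<open>right_annihilator F I\<close> are those of \<open>L \<otimes> I\<close>, and the
  tensors killed by \<open>left_annihilator F I\<close> are those of \<open>I \<otimes> L\<close>.
\<close>

definition right_annihilator :: "'a set \<Rightarrow> 'a set \<Rightarrow> ('a \<Rightarrow> 'a \<Rightarrow> 'a::comm_ring_1) set" where
  "right_annihilator F I = {\<beta> \<in> balanced F. \<forall>a. \<forall>i\<in>I. \<beta> a i = 0}"

definition left_annihilator :: "'a set \<Rightarrow> 'a set \<Rightarrow> ('a \<Rightarrow> 'a \<Rightarrow> 'a::comm_ring_1) set" where
  "left_annihilator F I = {\<beta> \<in> balanced F. \<forall>i\<in>I. \<forall>b. \<beta> i b = 0}"

lemma balancedD: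
  assumes "\<beta> \<in> balanced F"
  shows "\<beta> (a + a') b = \<beta> a b + \<beta> a' b" "\<beta> a (b + b') = \<beta> a b + \<beta> a b'"
    "f \<in> F \<Longrightarrow> \<beta> (f * a) b = \<beta> a (f * b)" "\<beta> 0 b = 0" "\<beta> a 0 = 0"
    "\<beta> (\<Sum>i\<in>A. h i) b = (\<Sum>i\<in>A. \<beta> (h i) b)" "\<beta> a (\<Sum>i\<in>A. h i) = (\<Sum>i\<in>A. \<beta> a (h i))"
proof -
  show *: "\<beta> (a + a') b = \<beta> a b + \<beta> a' b" "\<beta> a (b + b') = \<beta> a b + \<beta> a b'" for a a' b b'
    using assms by (auto simp: balanced_def)
  show "f \<in> F \<Longrightarrow> \<beta> (f * a) b = \<beta> a (f * b)"
    using assms by (auto simp: balanced_def)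
  show **: "\<beta> 0 b = 0" "\<beta> a 0 = 0" for a b
    using *(1)[of 0 0 b] *(2)[of a 0 0] by auto
  show "\<beta> (\<Sum>i\<in>A. h i) b = (\<Sum>i\<in>A. \<beta> (h i) b)" "\<beta> a (\<Sum>i\<in>A. h i) = (\<Sum>i\<in>A. \<beta> a (h i))"
    by (induction A rule: infinite_finite_induct) (auto simp: * **)
qed

lemma balanced_mult: "\<beta> \<in> balanced F \<Longrightarrow> (\<lambda>a b. \<beta> (c * a) (d * b)) \<in> balanced F"
  for c d :: "'a::comm_ring_1"
  by (auto simp: balanced_def distrib_left mult.left_commute)

lemma balanced_flip: "\<beta> \<in> balanced F \<Longrightarrow> (\<lambda>a b. \<beta> b a) \<in> balanced F"
  by (auto simp: balanced_def)

text \<open>\<open>constants_F\<close> ranges over the whole ambient field, since descent divides by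
  pivots there and the constants it produces have to lie in \<open>F\<close>.\<close>

locale difference_tensor = field_endomorphism \<sigma>
  for \<sigma> :: "'a::field \<Rightarrow> 'a" +
  fixes F R :: "'a set"
  assumes F: "is_subfield F" and R: "is_subring R" and FR: "F \<subseteq> R"
    and \<sigma>_F: "\<sigma> ` F \<subseteq> F" and constants_F: "\<sigma> x = x \<Longrightarrow> x \<in> F"
begin

section \<open>Congruence and constants in the tensor square\<close>

abbreviation null :: "'a tensor set" where
  "null \<equiv> vanishing (balanced F)"

lemma nullI: "(\<And>\<beta>. \<beta> \<in> balanced F \<Longrightarrow> eval_form \<beta> t = 0) \<Longrightarrow> t \<in> null"
  by (simp add: vanishing_def)

lemma null_mult: "t \<in> null \<Longrightarrow> s * t \<in> null" "t \<in> null \<Longrightarrow> t * s \<in> null"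
proof -
  show "t \<in> null \<Longrightarrow> s * t \<in> null"
    by (rule vanishing_mult) (auto intro: balanced_mult)
  then show "t \<in> null \<Longrightarrow> t * s \<in> null"
    by (simp add: mult.commute)
qed

lemma balanced_\<sigma>: "\<beta> \<in> balanced F \<Longrightarrow> (\<lambda>a b. \<beta> (\<sigma> a) (\<sigma> b)) \<in> balanced F"
  using \<sigma>_F by (auto simp: balanced_def hom_add hom_mult)

lemma null_tensor_map: "t \<in> null \<Longrightarrow> tensor_map \<sigma> t \<in> null"
  using balanced_\<sigma> by (auto simp: vanishing_def eval_form_tensor_map)

lemma null_swap: "t \<in> null \<Longrightarrow> swap t \<in> null"
  using balanced_flip by (auto simp: vanishing_def eval_form_swap)

lemma pure_add_left_null: "(a + a') \<otimes> b - (a \<otimes> b + a' \<otimes> b) \<in> null"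
  by (rule nullI) (simp add: eval_form_diff eval_form_add balancedD)

text \<open>The ring \<open>D\<close> of constants of \<open>R \<otimes> R\<close>. Invariance is
  required modulo \<open>null\<close>, the support condition on the representative itself.\<close>

definition const_tensors :: "'a tensor set" where
  "const_tensors = {d \<in> tensor_support R. tensor_map \<sigma> d - d \<in> null}"

lemma const_tensors_0: "0 \<in> const_tensors"
  by (simp add: const_tensors_def tensor_support_0 vanishing_0)

lemma const_tensors_add: "c \<in> const_tensors \<Longrightarrow> d \<in> const_tensors \<Longrightarrow> c + d \<in> const_tensors"
  using vanishing_add[of "tensor_map \<sigma> c - c" "balanced F" "tensor_map \<sigma> d - d"]
  by (auto simp: const_tensors_def tensor_support_add tensor_op_add algebra_simps)

lemma const_tensors_sum:
  "(\<And>i. i \<in> A \<Longrightarrow> d i \<in> const_tensors) \<Longrightarrow> (\<Sum>i\<in>A. d i) \<in> const_tensors"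
  by (induction A rule: infinite_finite_induct) (auto simp: const_tensors_0 const_tensors_add)

lemma const_tensors_mult:
  assumes "c \<in> const_tensors" "d \<in> const_tensors"
  shows "c * d \<in> const_tensors"
proof -
  have "(tensor_map \<sigma> c - c) * tensor_map \<sigma> d + c * (tensor_map \<sigma> d - d) \<in> null"
    using assms by (intro vanishing_add null_mult) (auto simp: const_tensors_def)
  also have "(tensor_map \<sigma> c - c) * tensor_map \<sigma> d + c * (tensor_map \<sigma> d - d) = tensor_map \<sigma> (c * d) - c * d"
    by (simp add: tensor_map_mult hom_mult algebra_simps)
  finally show ?thesis
    using assms by (simp add: const_tensors_def tensor_support_mult[OF R])
qed

lemma const_tensors_swap: "d \<in> const_tensors \<Longrightarrow> swap d \<in> const_tensors"
  using null_swap[of "tensor_map \<sigma> d - d"]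
  by (auto simp: const_tensors_def tensor_support_swap tensor_op_diff swap_tensor_map)

lemma pure_const_tensors: "\<sigma> c = c \<Longrightarrow> c \<otimes> 1 \<in> const_tensors"
  using constants_F FR is_subringD(2)[OF R]
  by (auto simp: const_tensors_def hom_1 vanishing_0 intro!: tensor_support_pure)

text \<open>Stands for the sums of products from \<open>(R \<otimes> 1) K\<close>. Including
  \<open>null\<close> makes the set closed under congruence.\<close>

inductive_set left_span :: "'a tensor set \<Rightarrow> 'a tensor set" for K where
  null: "t \<in> null \<Longrightarrow> t \<in> left_span K"
| gen: "r \<in> R \<Longrightarrow> d \<in> K \<Longrightarrow> r \<otimes> 1 * d \<in> left_span K"
| add: "s \<in> left_span K \<Longrightarrow> t \<in> left_span K \<Longrightarrow> s + t \<in> left_span K"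

lemma left_span_cong:
  assumes "s \<in> left_span K" "t - s \<in> null"
  shows "t \<in> left_span K"
  using left_span.add[OF assms(1) left_span.null[OF assms(2)]] by simp

lemma left_span_sum:
  "(\<And>i. i \<in> A \<Longrightarrow> t i \<in> left_span K) \<Longrightarrow> (\<Sum>i\<in>A. t i) \<in> left_span K"
  by (induction A rule: infinite_finite_induct)
    (auto intro: left_span.null[OF vanishing_0] left_span.add)

lemma left_span_mult:
  assumes s: "s \<in> left_span K" and t: "t \<in> left_span K'"
    and K: "\<And>c d. c \<in> K \<Longrightarrow> d \<in> K' \<Longrightarrow> c * d \<in> K''"
  shows "s * t \<in> left_span K''"
  using s
proof induction
  case (null s)
  then show ?case by (intro left_span.null null_mult)
next
  case (gen r d)
  show ?case
    using t
  proof induction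
    case (null t)
    then show ?case by (intro left_span.null null_mult)
  next
    case (gen r' d')
    have "(r * r') \<otimes> 1 * (d * d') \<in> left_span K''"
      using gen.hyps \<open>r \<in> R\<close> \<open>d \<in> K\<close> by (intro left_span.gen K is_subringD(4)[OF R])
    also have "(r * r') \<otimes> 1 * (d * d') = r \<otimes> 1 * d * (r' \<otimes> 1 * d')"
      using pure_mult[of r 1 r' 1] by (simp add: mult_ac)
    finally show ?case .
  next
    case (add s t)
    then show ?case by (simp add: distrib_left left_span.add)
  qed
next
  case (add s s')
  then show ?case by (simp add: distrib_right left_span.add)
qed

lemma left_span_list:
  assumes "t \<in> left_span K"
  obtains ps where "set ps \<subseteq> R \<times> K" "t - (\<Sum>p\<leftarrow>ps. fst p \<otimes> 1 * snd p) \<in> null"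
proof -
  have "\<exists>ps. set ps \<subseteq> R \<times> K \<and> t - (\<Sum>p\<leftarrow>ps. fst p \<otimes> 1 * snd p) \<in> null"
    using assms
  proof induction
    case (null t)
    then show ?case by (intro exI[of _ "[]"]) auto
  next
    case (gen r d)
    then show ?case by (intro exI[of _ "[(r, d)]"]) (auto simp: vanishing_0)
  next
    case (add s t)
    then obtain ps qs where "set ps \<subseteq> R \<times> K" "s - (\<Sum>p\<leftarrow>ps. fst p \<otimes> 1 * snd p) \<in> null"
      "set qs \<subseteq> R \<times> K" "t - (\<Sum>p\<leftarrow>qs. fst p \<otimes> 1 * snd p) \<in> null" by auto
    moreover from vanishing_add[OF this(2) this(4)]
    have "s + t - (\<Sum>p\<leftarrow>ps @ qs. fst p \<otimes> 1 * snd p) \<in> null"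
      by (simp add: algebra_simps)
    ultimately show ?case by (intro exI[of _ "ps @ qs"]) auto
  qed
  then show thesis using that by auto
qed

text \<open>Padding with \<open>0\<close> beyond \<open>n\<close> turns the coefficients into a
  finitely supported vector indexed by \<open>nat\<close>, the form in which descent takes
  them.\<close>

lemma left_span_coords:
  assumes "t \<in> left_span K"
  obtains n :: nat and r d where "\<And>i. r i \<in> R" "\<And>i. i < n \<Longrightarrow> d i \<in> K" "\<And>i. i \<ge> n \<Longrightarrow> r i = 0"
    "t - (\<Sum>i<n. r i \<otimes> 1 * d i) \<in> null"
proof -
  obtain ps where ps: "set ps \<subseteq> R \<times> K" "t - (\<Sum>p\<leftarrow>ps. fst p \<otimes> 1 * snd p) \<in> null"
    using left_span_list[OF assms] .
  define r where "r i = (if i < length ps then fst (ps ! i) else 0)" for i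
  have mem: "ps ! i \<in> R \<times> K" if "i < length ps" for i
    using ps(1) that nth_mem by blast
  show thesis
  proof (rule that)
    show "r i \<in> R" for i
      using mem[of i] is_subringD(1)[OF R] by (auto simp: r_def mem_Times_iff)
    show "snd (ps ! i) \<in> K" if "i < length ps" for i
      using mem[OF that] by (simp add: mem_Times_iff)
    show "r i = 0" if "i \<ge> length ps" for i
      using that by (simp add: r_def)
    have "(\<Sum>p\<leftarrow>ps. fst p \<otimes> 1 * snd p) = (\<Sum>i<length ps. r i \<otimes> 1 * snd (ps ! i))"
      by (simp add: sum_list_sum_nth r_def atLeast0LessThan)
    then show "t - (\<Sum>i<length ps. r i \<otimes> 1 * snd (ps ! i)) \<in> null"
      using ps(2) by simp
  qed
qed

section \<open>Combinations of constants and descent\<close>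

abbreviation combination :: "nat \<Rightarrow> (nat \<Rightarrow> 'a tensor) \<Rightarrow> (nat \<Rightarrow> 'a) \<Rightarrow> 'a tensor" where
  "combination n d v \<equiv> (\<Sum>i<n. v i \<otimes> 1 * d i)"

lemma combination_add:
  "combination n d (\<lambda>i. v i + w i) - (combination n d v + combination n d w) \<in> null"
proof -
  have "((v i + w i) \<otimes> 1 - (v i \<otimes> 1 + w i \<otimes> 1)) * d i \<in> null" for i
    by (intro null_mult pure_add_left_null)
  then have "(\<Sum>i<n. ((v i + w i) \<otimes> 1 - (v i \<otimes> 1 + w i \<otimes> 1)) * d i) \<in> null"
    by (intro vanishing_sum)
  then show ?thesis
    by (simp add: algebra_simps sum.distrib sum_subtractf)
qed

lemma combination_scale: "combination n d (\<lambda>i. c * v i) = c \<otimes> 1 * combination n d v"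
proof -
  have "(c * v i) \<otimes> 1 = c \<otimes> 1 * v i \<otimes> 1" for i
    using pure_mult[of c 1 "v i" 1] by simp
  then show ?thesis
    by (simp add: sum_distrib_left mult.assoc)
qed

text \<open>Since each \<open>d i\<close> is constant, \<open>\<sigma>\<close> acts on a combination
  through its coefficients alone.\<close>

lemma combination_\<sigma>:
  assumes "\<And>i. i < n \<Longrightarrow> d i \<in> const_tensors"
  shows "combination n d (\<lambda>i. \<sigma> (v i)) - tensor_map \<sigma> (combination n d v) \<in> null"
proof -
  have "\<sigma> (v i) \<otimes> 1 * (d i - tensor_map \<sigma> (d i)) \<in> null" if "i < n" for i
    using assms[OF that] vanishing_uminus[of "tensor_map \<sigma> (d i) - d i" "balanced F"]
    by (intro null_mult) (auto simp: const_tensors_def)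
  then have "(\<Sum>i<n. \<sigma> (v i) \<otimes> 1 * (d i - tensor_map \<sigma> (d i))) \<in> null"
    by (intro vanishing_sum) auto
  then show ?thesis
    by (simp add: tensor_map_sum tensor_map_mult hom_mult hom_1 algebra_simps sum_subtractf)
qed

lemma null_combination_0: "combination n d (\<lambda>_. 0) \<in> null"
proof -
  have "0 \<otimes> 1 \<in> null"
    by (rule nullI) (simp add: balancedD)
  then show ?thesis
    by (intro vanishing_sum null_mult)
qed

lemma const_combination:
  assumes "\<And>i. i < n \<Longrightarrow> d i \<in> const_tensors" "\<And>i. \<sigma> (e i) = e i"
  shows "combination n d e \<in> const_tensors"
  using assms by (auto intro!: const_tensors_sum const_tensors_mult pure_const_tensors)

text \<open>Left scalars range over the whole ambient field, not only over \<open>R\<close>, because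
  descent normalizes pivots to \<open>1\<close>.\<close>

definition stable_subspace :: "'a tensor set \<Rightarrow> bool" where
  "stable_subspace W \<longleftrightarrow> null \<subseteq> W \<and> (\<forall>s\<in>W. \<forall>t\<in>W. s + t \<in> W) \<and>
     (\<forall>c. \<forall>t\<in>W. c \<otimes> 1 * t \<in> W) \<and> (\<forall>t\<in>W. tensor_map \<sigma> t \<in> W)"

lemma stable_subspaceD:
  assumes "stable_subspace W"
  shows "t \<in> null \<Longrightarrow> t \<in> W" "s \<in> W \<Longrightarrow> t \<in> W \<Longrightarrow> s + t \<in> W" "t \<in> W \<Longrightarrow> c \<otimes> 1 * t \<in> W"
    "t \<in> W \<Longrightarrow> tensor_map \<sigma> t \<in> W" "s \<in> W \<Longrightarrow> t - s \<in> null \<Longrightarrow> t \<in> W"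
proof -
  show *: "t \<in> null \<Longrightarrow> t \<in> W" "s \<in> W \<Longrightarrow> t \<in> W \<Longrightarrow> s + t \<in> W" "t \<in> W \<Longrightarrow> c \<otimes> 1 * t \<in> W"
    "t \<in> W \<Longrightarrow> tensor_map \<sigma> t \<in> W" for s t c
    using assms unfolding stable_subspace_def by blast+
  show "s \<in> W \<Longrightarrow> t - s \<in> null \<Longrightarrow> t \<in> W"
    using *(2)[of s "t - s"] *(1)[of "t - s"] by simp
qed

text \<open>The coefficient vectors whose combination lies in \<open>W\<close> form a
  \<open>\<sigma>\<close>-stable space, to which descent applies. A constant vector in it gives a
  combination that is constant and lies in \<open>W\<close>, and the multipliers in front stay in
  \<open>R\<close>.\<close>

lemma stable_subspace_span:
  assumes W: "stable_subspace W" and "t \<in> left_span const_tensors" "t \<in> W"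
  shows "t \<in> left_span (const_tensors \<inter> W)"
proof -
  obtain n r d where r: "\<And>i. r i \<in> R" and d: "\<And>i. i < n \<Longrightarrow> d i \<in> const_tensors"
    and r_0: "\<And>i. i \<ge> n \<Longrightarrow> r i = 0" and t: "t - combination n d r \<in> null"
    by (rule left_span_coords[OF assms(2)]) (rule that)
  define \<Lambda> where "\<Lambda> = {v. (\<forall>i\<ge>n. v i = 0) \<and> combination n d v \<in> W}"
  note W' = stable_subspaceD[OF W]
  have "combination n d r \<in> left_span (const_tensors \<inter> W)"
  proof (rule constant_vectors_span[where S = "{..<n}" and \<Lambda> = \<Lambda> and \<sigma> = \<sigma> and R = R and r = r
        and P = "\<lambda>v. combination n d v \<in> left_span (const_tensors \<inter> W)"])
    show "v i = 0" if "v \<in> \<Lambda>" "i \<notin> {..<n}" for v i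
      using that by (auto simp: \<Lambda>_def)
    show "(\<lambda>i. v i + w i) \<in> \<Lambda>" if "v \<in> \<Lambda>" "w \<in> \<Lambda>" for v w
      using that W'(5)[OF W'(2) combination_add] by (auto simp: \<Lambda>_def)
    show "(\<lambda>i. c * v i) \<in> \<Lambda>" if "v \<in> \<Lambda>" for c v
      using that W'(3) by (auto simp: \<Lambda>_def combination_scale)
    show "(\<lambda>i. \<sigma> (v i)) \<in> \<Lambda>" if "v \<in> \<Lambda>" for v
      using that W'(5)[OF W'(4) combination_\<sigma>[OF d]] by (auto simp: \<Lambda>_def hom_0)
    show "x \<in> R" if "\<sigma> x = x" for x
      using constants_F[OF that] FR by auto
    show "combination n d (\<lambda>_. 0) \<in> left_span (const_tensors \<inter> W)"
      by (rule left_span.null[OF null_combination_0])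
    show "combination n d (\<lambda>i. v i + w i) \<in> left_span (const_tensors \<inter> W)"
      if "combination n d v \<in> left_span (const_tensors \<inter> W)"
        "combination n d w \<in> left_span (const_tensors \<inter> W)" for v w
      by (rule left_span_cong[OF left_span.add[OF that] combination_add])
    show "combination n d (\<lambda>i. \<rho> * e i) \<in> left_span (const_tensors \<inter> W)"
      if "\<rho> \<in> R" "e \<in> \<Lambda>" "\<And>i. \<sigma> (e i) = e i" for \<rho> e
      unfolding combination_scale using that d
      by (intro left_span.gen) (auto simp: \<Lambda>_def intro!: const_combination)
    have "combination n d r - t \<in> null"
      using vanishing_uminus[OF t] by simp
    then show "r \<in> \<Lambda>"
      using r_0 W'(5)[OF \<open>t \<in> W\<close>] by (auto simp: \<Lambda>_def)
  qed (use r hom_0 hom_1 R in auto)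
  then show ?thesis using t by (rule left_span_cong)
qed

text \<open>The relations expressing a tensor \<open>x \<otimes> 1\<close> through the
  \<open>d i\<close> form a \<open>\<sigma>\<close>-stable space of vectors. One of them has leading
  coordinate \<open>h \<noteq> 0\<close>, so descent yields a constant relation with nonzero leading
  coordinate \<open>e\<close>. Its coefficients lie in \<open>F\<close>, so closure of
  \<open>W\<close> under scalars from \<open>F\<close> puts \<open>e \<otimes> 1\<close> in
  \<open>W\<close>.\<close>

lemma constant_pure_in_subspace:
  assumes W_null: "null \<subseteq> W" and W_add: "\<And>s t. s \<in> W \<Longrightarrow> t \<in> W \<Longrightarrow> s + t \<in> W"
    and W_scale: "\<And>c t. c \<in> F \<Longrightarrow> t \<in> W \<Longrightarrow> c \<otimes> 1 * t \<in> W"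
    and span: "h \<otimes> 1 \<in> left_span (const_tensors \<inter> W)"
    and "h \<in> R" "h \<noteq> 0"
  obtains e where "\<sigma> e = e" "e \<noteq> 0" "e \<otimes> 1 \<in> W"
proof -
  obtain n r d where r: "\<And>i. r i \<in> R" and d: "\<And>i. i < n \<Longrightarrow> d i \<in> const_tensors \<inter> W"
    and r_0: "\<And>i. i \<ge> n \<Longrightarrow> r i = 0" and h: "h \<otimes> 1 - combination n d r \<in> null"
    by (rule left_span_coords[OF span]) (rule that)
  \<comment> \<open>Coordinate \<open>0\<close> holds the element on the left of the relation and
    coordinate \<open>Suc i\<close> the coefficient of \<open>d i\<close>, so the support lies in
    \<open>{..n}\<close>.\<close>
  define \<Lambda> where "\<Lambda> = {v. (\<forall>i>n. v i = 0) \<and> v 0 \<otimes> 1 - combination n d (\<lambda>i. v (Suc i)) \<in> null}"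
  define u where "u = case_nat h r"
  have u: "u \<in> \<Lambda>" "u i \<in> R" for i
    using r r_0 h \<open>h \<in> R\<close> by (auto simp: \<Lambda>_def u_def split: nat.split)
  define Q where "Q \<longleftrightarrow> (\<exists>e. \<sigma> e = e \<and> e \<noteq> 0 \<and> e \<otimes> 1 \<in> W)"
  \<comment> \<open>This property passes to sums: if coordinate \<open>0\<close> of a sum is
    nonzero, so is that of a summand. It remains to treat multiples of constant vectors.\<close>
  have "u 0 \<noteq> 0 \<longrightarrow> Q"
  proof (rule constant_vectors_span[where S = "{..n}" and \<Lambda> = \<Lambda> and \<sigma> = \<sigma> and R = R and r = u
        and P = "\<lambda>v. v 0 \<noteq> 0 \<longrightarrow> Q"])
    show "v i = 0" if "v \<in> \<Lambda>" "i \<notin> {..n}" for v i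
      using that by (auto simp: \<Lambda>_def)
    show "(\<lambda>i. v i + w i) \<in> \<Lambda>" if "v \<in> \<Lambda>" "w \<in> \<Lambda>" for v w
    proof -
      let ?c = "\<lambda>v. combination n d (\<lambda>i. v (Suc i))"
      have v: "v 0 \<otimes> 1 - ?c v \<in> null" and w: "w 0 \<otimes> 1 - ?c w \<in> null"
        using that by (auto simp: \<Lambda>_def)
      have "(v 0 \<otimes> 1 - ?c v) + (w 0 \<otimes> 1 - ?c w)
          + ((v 0 + w 0) \<otimes> 1 - (v 0 \<otimes> 1 + w 0 \<otimes> 1)) - (?c (\<lambda>i. v i + w i) - (?c v + ?c w)) \<in> null"
        by (rule vanishing_diff[OF vanishing_add[OF vanishing_add[OF v w] pure_add_left_null] combination_add])
      then show ?thesis using that by (simp add: \<Lambda>_def algebra_simps)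
    qed
    show "(\<lambda>i. c * v i) \<in> \<Lambda>" if "v \<in> \<Lambda>" for c v
    proof -
      have "c \<otimes> 1 * (v 0 \<otimes> 1 - combination n d (\<lambda>i. v (Suc i))) \<in> null"
        using that by (intro null_mult) (auto simp: \<Lambda>_def)
      then show ?thesis
        using that pure_mult[of c 1 "v 0" 1] by (simp add: \<Lambda>_def combination_scale right_diff_distrib)
    qed
    show "(\<lambda>i. \<sigma> (v i)) \<in> \<Lambda>" if "v \<in> \<Lambda>" for v
    proof -
      let ?c = "combination n d (\<lambda>i. v (Suc i))"
      have v: "v 0 \<otimes> 1 - ?c \<in> null"
        using that by (auto simp: \<Lambda>_def)
      have "tensor_map \<sigma> (v 0 \<otimes> 1 - ?c) - (combination n d (\<lambda>i. \<sigma> (v (Suc i))) - tensor_map \<sigma> ?c) \<in> null"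
        using d by (intro vanishing_diff[OF null_tensor_map[OF v] combination_\<sigma>]) auto
      then show ?thesis
        using that by (simp add: \<Lambda>_def tensor_op_diff hom_0 hom_1 algebra_simps)
    qed
    show "x \<in> R" if "\<sigma> x = x" for x
      using constants_F[OF that] FR by auto
    show "\<rho> * e 0 \<noteq> 0 \<longrightarrow> Q" if "\<rho> \<in> R" "e \<in> \<Lambda>" and e_const: "\<And>i. \<sigma> (e i) = e i" for \<rho> e
    proof
      assume "\<rho> * e 0 \<noteq> 0"
      have "combination m d (\<lambda>i. e (Suc i)) \<in> W" if "m \<le> n" for m
        using that
      proof (induction m)
        case 0
        then show ?case using W_null vanishing_0 by auto
      next
        case (Suc m)
        then show ?case
          using d constants_F[OF e_const[of "Suc m"]] by (auto intro!: W_add W_scale)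
      qed
      moreover have "e 0 \<otimes> 1 - combination n d (\<lambda>i. e (Suc i)) \<in> W"
        using \<open>e \<in> \<Lambda>\<close> W_null by (auto simp: \<Lambda>_def)
      ultimately have "e 0 \<otimes> 1 \<in> W"
        using W_add by fastforce
      then show Q
        using \<open>\<rho> * e 0 \<noteq> 0\<close> that(3) by (auto simp: Q_def)
    qed
  qed (use u hom_0 hom_1 R in auto)
  then have Q using \<open>h \<noteq> 0\<close> by (simp add: u_def)
  then show thesis using that by (auto simp: Q_def)
qed

section \<open>Ideals of \<open>R\<close> stable under \<open>\<sigma>\<close>\<close>

context
  fixes I
  assumes I: "ideal_of R I" and \<sigma>_I: "\<sigma> ` I \<subseteq> I"
begin

lemma ideal_mult: "r \<in> R \<Longrightarrow> i \<in> I \<Longrightarrow> r * i \<in> I"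
  using I by (auto simp: ideal_of_def)

text \<open>\<open>I \<otimes> L\<close> absorbs \<open>R \<otimes> R\<close> because
  \<open>I\<close> is an ideal of \<open>R\<close>; a left scalar from outside \<open>R\<close>
  could leave it.\<close>

lemma left_annihilator_mult:
  assumes "s \<in> tensor_support R" "t \<in> vanishing (left_annihilator F I)"
  shows "s * t \<in> vanishing (left_annihilator F I)"
proof (rule vanishing_mult)
  fix p \<beta> assume p: "p \<in> Poly_Mapping.keys s" and \<beta>: "\<beta> \<in> left_annihilator F I"
  have "lft p * i \<in> I" if "i \<in> I" for i
    using that p assms(1) ideal_mult by (auto simp: tensor_support_def)
  then show "(\<lambda>a b. \<beta> (lft p * a) (rgt p * b)) \<in> left_annihilator F I"
    using \<beta> balanced_mult[of \<beta>] by (auto simp: left_annihilator_def)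
qed fact

lemma swap_annihilator:
  assumes "t \<in> vanishing (right_annihilator F I)"
  shows "swap t \<in> vanishing (left_annihilator F I)"
proof -
  have "(\<lambda>a b. \<beta> b a) \<in> right_annihilator F I" if "\<beta> \<in> left_annihilator F I" for \<beta>
    using that balanced_flip[of \<beta>] by (auto simp: left_annihilator_def right_annihilator_def)
  then show ?thesis
    using assms unfolding vanishing_def mem_Collect_eq eval_form_swap by blast
qed

lemma null_left_annihilator: "null \<subseteq> vanishing (left_annihilator F I)"
  by (rule vanishing_antimono) (auto simp: left_annihilator_def)

text \<open>Left scalars touch only the first factor of \<open>L \<otimes> I\<close>, so every field
  element is allowed; \<open>\<sigma>_I\<close> handles the second factor.\<close>

lemma stable_subspace_right_annihilator: "stable_subspace (vanishing (right_annihilator F I))"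
proof -
  have "null \<subseteq> vanishing (right_annihilator F I)"
    by (rule vanishing_antimono) (auto simp: right_annihilator_def)
  moreover have "c \<otimes> 1 * t \<in> vanishing (right_annihilator F I)"
    if "t \<in> vanishing (right_annihilator F I)" for c t
  proof (rule vanishing_mult)
    fix p \<beta> assume "p \<in> Poly_Mapping.keys (c \<otimes> 1)" "\<beta> \<in> right_annihilator F I"
    then show "(\<lambda>a b. \<beta> (lft p * a) (rgt p * b)) \<in> right_annihilator F I"
      using balanced_mult[of \<beta> F c 1] by (auto simp: right_annihilator_def)
  qed fact
  moreover have "tensor_map \<sigma> t \<in> vanishing (right_annihilator F I)"
    if "t \<in> vanishing (right_annihilator F I)" for t
  proof -
    have "(\<lambda>a b. \<beta> (\<sigma> a) (\<sigma> b)) \<in> right_annihilator F I" if "\<beta> \<in> right_annihilator F I" for \<beta>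
      using that balanced_\<sigma>[of \<beta>] \<sigma>_I by (auto simp: right_annihilator_def)
    then show ?thesis
      using that unfolding vanishing_def mem_Collect_eq eval_form_tensor_map by blast
  qed
  ultimately show ?thesis
    unfolding stable_subspace_def by (auto intro: vanishing_add)
qed

text \<open>The exchange turns \<open>r \<otimes> 1\<close> into \<open>1 \<otimes> r\<close>, which
  \<open>gen\<close> rewrites as a left combination of constants. These multiply swapped constants
  lying in \<open>I \<otimes> L\<close>, and the products stay there.\<close>

lemma right_to_left_span:
  assumes gen: "\<And>r. r \<in> R \<Longrightarrow> 1 \<otimes> r \<in> left_span const_tensors"
    and "t \<in> left_span (const_tensors \<inter> vanishing (right_annihilator F I))"
  shows "swap t \<in> left_span (const_tensors \<inter> vanishing (left_annihilator F I))"
  using assms(2)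
proof induction
  case (null t)
  then show ?case by (intro left_span.null null_swap)
next
  case (gen r d)
  have "1 \<otimes> 1 * swap d \<in> left_span (const_tensors \<inter> vanishing (left_annihilator F I))"
    using gen is_subringD(2)[OF R]
    by (intro left_span.gen) (auto intro: const_tensors_swap swap_annihilator)
  then have "1 \<otimes> r * (1 \<otimes> 1 * swap d) \<in> left_span (const_tensors \<inter> vanishing (left_annihilator F I))"
    by (rule left_span_mult[OF assms(1)[OF gen(1)]])
      (use const_tensors_mult left_annihilator_mult const_tensors_def in blast)
  then show ?case by (simp add: swap_mult pure_one)
next
  case (add s t)
  then show ?case by (simp add: tensor_op_add left_span.add)
qed

theorem nonzero_ideal_contains_1:
  assumes "\<And>r. r \<in> R \<Longrightarrow> 1 \<otimes> r \<in> left_span const_tensors"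
    and "h \<in> I" "h \<noteq> 0"
  shows "1 \<in> I"
proof (rule ccontr)
  assume "1 \<notin> I"
  have IR: "I \<subseteq> R" using I by (simp add: ideal_of_def)
  \<comment> \<open>Descent starts in \<open>L \<otimes> I\<close>, which admits all left scalars;
    \<open>I \<otimes> L\<close> is reached afterwards by exchanging the factors.\<close>
  have "1 \<otimes> h \<in> vanishing (right_annihilator F I)"
    using \<open>h \<in> I\<close> by (auto simp: vanishing_def right_annihilator_def)
  then have "1 \<otimes> h \<in> left_span (const_tensors \<inter> vanishing (right_annihilator F I))"
    using assms IR by (intro stable_subspace_span stable_subspace_right_annihilator) auto
  from right_to_left_span[OF assms(1) this]
  have span: "h \<otimes> 1 \<in> left_span (const_tensors \<inter> vanishing (left_annihilator F I))" by simp
  obtain e where e: "\<sigma> e = e" "e \<noteq> 0" "e \<otimes> 1 \<in> vanishing (left_annihilator F I)"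
  proof (rule constant_pure_in_subspace[OF null_left_annihilator vanishing_add _ span])
    show "c \<otimes> 1 * t \<in> vanishing (left_annihilator F I)"
      if "c \<in> F" "t \<in> vanishing (left_annihilator F I)" for c t
      using that FR is_subringD(2)[OF R] by (intro left_annihilator_mult tensor_support_pure) auto
  qed (use assms IR in auto)
  obtain \<phi> where \<phi>: "\<And>x y. \<phi> (x + y) = \<phi> x + \<phi> y" "\<And>f x. f \<in> F \<Longrightarrow> \<phi> (f * x) = f * \<phi> x"
    "\<And>x. x \<in> I \<Longrightarrow> \<phi> x = 0" "\<phi> 1 = 1"
    by (rule subspace_functional[OF F, of I]) (use I FR \<open>1 \<notin> I\<close> in \<open>auto simp: ideal_of_def\<close>)
  \<comment> \<open>Multiplying by \<open>b\<close> turns the functional into a balanced form that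
    kills \<open>I\<close> in the first argument and has value \<open>\<phi> e\<close> at
    \<open>e \<otimes> 1\<close>.\<close>
  have "(\<lambda>a b. \<phi> a * b) \<in> left_annihilator F I"
    by (auto simp: left_annihilator_def balanced_def \<phi> algebra_simps)
  then have "\<phi> e = 0"
    using e(3) by (auto simp: vanishing_def)
  moreover have "\<phi> e = e"
    using \<phi>(2)[OF constants_F[OF e(1)], of 1] \<phi>(4) by simp
  ultimately show False using e(2) by simp
qed

end

section \<open>Elements \<open>r\<close> for which constants generate
  \<open>1 \<otimes> r\<close>\<close>

lemma pure_right_F: "f \<in> F \<Longrightarrow> 1 \<otimes> f \<in> left_span const_tensors"
proof (rule left_span_cong)
  assume "f \<in> F"
  then show "f \<otimes> 1 * 1 \<otimes> 1 \<in> left_span const_tensors"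
    using FR hom_1 by (intro left_span.gen pure_const_tensors) auto
  show "1 \<otimes> f - f \<otimes> 1 * 1 \<otimes> 1 \<in> null"
    using \<open>f \<in> F\<close> by (intro nullI) (auto simp: pure_mult eval_form_diff dest: balancedD(3)[of _ F f 1 1])
qed

lemma pure_right_subring: "is_subring {r \<in> R. 1 \<otimes> r \<in> left_span const_tensors}"
proof -
  have "1 \<otimes> (a + b) \<in> left_span const_tensors"
    if "1 \<otimes> a \<in> left_span const_tensors" "1 \<otimes> b \<in> left_span const_tensors" for a b
    by (rule left_span_cong[OF left_span.add[OF that]], rule nullI)
      (simp add: eval_form_diff eval_form_add balancedD)
  moreover have mult: "1 \<otimes> (a * b) \<in> left_span const_tensors"
    if "1 \<otimes> a \<in> left_span const_tensors" "1 \<otimes> b \<in> left_span const_tensors" for a b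
    using left_span_mult[OF that const_tensors_mult] by (simp add: pure_mult)
  moreover have F_mem: "0 \<in> F" "1 \<in> F" "- 1 \<in> F"
    using F is_subringD[of F] by (auto simp: is_subfield_def)
  moreover have "1 \<otimes> (- a) \<in> left_span const_tensors"
    if "1 \<otimes> a \<in> left_span const_tensors" for a
    using mult[OF pure_right_F[OF F_mem(3)] that] by simp
  ultimately show ?thesis
    unfolding is_subring_def using is_subringD[OF R] pure_right_F by auto
qed

text \<open>The derivation \<open>\<delta> \<otimes> 1 + 1 \<otimes> \<delta>\<close> preserves
  \<open>null\<close> because \<open>F\<close> is \<open>\<delta>\<close>-stable, and constants
  because \<open>\<delta>\<close> commutes with \<open>\<sigma>\<close>; by the Leibniz rule it
  preserves the left span. Its value at \<open>1 \<otimes> r\<close> is congruent to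
  \<open>1 \<otimes> \<delta> r\<close>, as \<open>\<delta> 1 = 0\<close>.\<close>

lemma pure_right_deriv:
  assumes \<delta>_add: "\<And>x y. \<delta> (x + y) = \<delta> x + \<delta> y"
    and \<delta>_mult: "\<And>x y. \<delta> (x * y) = \<delta> x * y + x * \<delta> y"
    and comm: "\<And>x. \<sigma> (\<delta> x) = \<delta> (\<sigma> x)" and \<delta>_F: "\<delta> ` F \<subseteq> F" and \<delta>_R: "\<delta> ` R \<subseteq> R"
    and "1 \<otimes> r \<in> left_span const_tensors"
  shows "1 \<otimes> \<delta> r \<in> left_span const_tensors"
proof -
  have null_deriv: "tensor_deriv \<delta> t \<in> null" if "t \<in> null" for t
  proof (rule nullI)
    fix \<beta> assume \<beta>: "\<beta> \<in> balanced F"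
    \<comment> \<open>Replacing \<open>a\<close> by \<open>f * a\<close> or \<open>b\<close> by
      \<open>f * b\<close> creates a term with \<open>\<delta> f\<close>; the two agree because
      \<open>\<delta> f\<close> lies in \<open>F\<close>.\<close>
    have "(\<lambda>a b. \<beta> (\<delta> a) b + \<beta> a (\<delta> b)) \<in> balanced F"
      using \<delta>_F balancedD(1-3)[OF \<beta>]
      by (auto simp: balanced_def \<delta>_add \<delta>_mult image_subset_iff)
    then show "eval_form \<beta> (tensor_deriv \<delta> t) = 0"
      using that by (simp add: eval_form_tensor_deriv vanishing_def)
  qed
  have const_deriv: "tensor_deriv \<delta> d \<in> const_tensors" if "d \<in> const_tensors" for d
    using that null_deriv[of "tensor_map \<sigma> d - d"] tensor_support_tensor_deriv[OF \<delta>_R]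
    by (auto simp: const_tensors_def tensor_op_diff tensor_deriv_tensor_map[of \<sigma> \<delta>] comm)
  \<comment> \<open>The rule holds only modulo \<open>null\<close>, since formal sums are not
    biadditive in their components.\<close>
  have leibniz: "tensor_deriv \<delta> (r \<otimes> 1 * t) - (\<delta> r \<otimes> 1 * t + r \<otimes> 1 * tensor_deriv \<delta> t) \<in> null" for r t
  proof (rule nullI)
    fix \<beta> assume \<beta>: "\<beta> \<in> balanced F"
    show "eval_form \<beta> (tensor_deriv \<delta> (r \<otimes> 1 * t) - (\<delta> r \<otimes> 1 * t + r \<otimes> 1 * tensor_deriv \<delta> t)) = 0"
    proof (induction t rule: tensor_induct)
      case (pure a b)
      then show ?case
        by (simp add: pure_mult eval_form_diff eval_form_add eval_form_uminus \<delta>_mult balancedD[OF \<beta>] distrib_left)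
    next
      case (diff s t)
      then show ?case
        by (simp add: tensor_op_diff eval_form_diff eval_form_add right_diff_distrib)
    qed simp
  qed
  have "tensor_deriv \<delta> t \<in> left_span const_tensors" if "t \<in> left_span const_tensors" for t
    using that
  proof induction
    case (null t)
    then show ?case by (intro left_span.null null_deriv)
  next
    case (gen r d)
    then show ?case
      using \<delta>_R by (intro left_span_cong[OF left_span.add leibniz] left_span.gen const_deriv) auto
  next
    case (add s t)
    then show ?case by (simp add: tensor_op_add left_span.add)
  qed
  from this[OF assms(6)] show ?thesis
  proof (rule left_span_cong)
    have "\<delta> 1 = 0" using \<delta>_mult[of 1 1] by (metis add.right_neutral add_left_imp_eq mult.left_neutral mult.right_neutral)
    then show "1 \<otimes> \<delta> r - tensor_deriv \<delta> (1 \<otimes> r) \<in> null"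
      by (intro nullI) (simp add: eval_form_diff eval_form_add eval_form_uminus balancedD)
  qed
qed

end

subsection \<open>Fundamental matrices\<close>

context difference_tensor
begin

text \<open>The entries of \<open>(W \<otimes> 1)(1 \<otimes> X)\<close> are constant:
  \<open>\<sigma>\<close> multiplies \<open>X\<close> by \<open>A\<close> and \<open>W\<close> by
  the inverse of \<open>A\<close>, and the entries of \<open>A\<close> cross the tensor sign.
  Multiplying by \<open>X \<otimes> 1\<close> on the left recovers
  \<open>1 \<otimes> X\<close>.\<close>

lemma pure_right_matrix:
  assumes X: "\<And>i j. X $ i $ j \<in> R" and W: "\<And>i j. W $ i $ j \<in> R" and A: "\<And>i j. A $ i $ j \<in> F"
    and XW: "X ** W = mat 1" and \<sigma>X: "map_matrix \<sigma> X = A ** X" and \<sigma>W: "map_matrix \<sigma> W ** A = W"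
  shows "1 \<otimes> X $ i $ j \<in> left_span const_tensors"
proof -
  define d where "d l = (\<Sum>p\<in>UNIV. W $ l $ p \<otimes> X $ p $ j)" for l
  have \<sigma>X': "\<sigma> (X $ p $ j) = (\<Sum>s\<in>UNIV. A $ p $ s * X $ s $ j)" for p
    using arg_cong[OF \<sigma>X, of "\<lambda>M. M $ p $ j"] by (simp add: map_matrix_def matrix_matrix_mult_def)
  have \<sigma>W': "(\<Sum>p\<in>UNIV. A $ p $ s * \<sigma> (W $ l $ p)) = W $ l $ s" for l s
    using arg_cong[OF \<sigma>W, of "\<lambda>M. M $ l $ s"]
    by (simp add: map_matrix_def matrix_matrix_mult_def mult.commute)
  have "d l \<in> const_tensors" for l
    unfolding const_tensors_def
  proof (intro CollectI conjI nullI)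
    show "d l \<in> tensor_support R"
      unfolding d_def using X W by (intro tensor_support_sum tensor_support_pure)
    fix \<beta> assume \<beta>: "\<beta> \<in> balanced F"
    have "eval_form \<beta> (tensor_map \<sigma> (d l)) = (\<Sum>p\<in>UNIV. \<Sum>s\<in>UNIV. \<beta> (\<sigma> (W $ l $ p)) (A $ p $ s * X $ s $ j))"
      by (simp add: d_def tensor_map_sum eval_form_sum \<sigma>X' balancedD(7)[OF \<beta>])
    also have "\<dots> = (\<Sum>p\<in>UNIV. \<Sum>s\<in>UNIV. \<beta> (A $ p $ s * \<sigma> (W $ l $ p)) (X $ s $ j))"
      using A by (simp add: balancedD(3)[OF \<beta>])
    also have "\<dots> = (\<Sum>s\<in>UNIV. \<Sum>p\<in>UNIV. \<beta> (A $ p $ s * \<sigma> (W $ l $ p)) (X $ s $ j))"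
      by (rule sum.swap)
    also have "\<dots> = (\<Sum>s\<in>UNIV. \<beta> (W $ l $ s) (X $ s $ j))"
      by (simp add: \<sigma>W' flip: balancedD(6)[OF \<beta>])
    also have "\<dots> = eval_form \<beta> (d l)"
      by (simp add: d_def eval_form_sum)
    finally show "eval_form \<beta> (tensor_map \<sigma> (d l) - d l) = 0"
      by (simp add: eval_form_diff)
  qed
  then have "(\<Sum>l\<in>UNIV. X $ i $ l \<otimes> 1 * d l) \<in> left_span const_tensors"
    using X by (intro left_span_sum left_span.gen)
  then show ?thesis
  proof (rule left_span_cong)
    show "1 \<otimes> X $ i $ j - (\<Sum>l\<in>UNIV. X $ i $ l \<otimes> 1 * d l) \<in> null"
    proof (rule nullI)
      fix \<beta> assume \<beta>: "\<beta> \<in> balanced F"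
      have XW': "(\<Sum>l\<in>UNIV. X $ i $ l * W $ l $ p) = (if i = p then 1 else 0)" for p
        using arg_cong[OF XW, of "\<lambda>M. M $ i $ p"] by (simp add: matrix_matrix_mult_def mat_def)
      have "eval_form \<beta> (\<Sum>l\<in>UNIV. X $ i $ l \<otimes> 1 * d l)
          = (\<Sum>l\<in>UNIV. \<Sum>p\<in>UNIV. \<beta> (X $ i $ l * W $ l $ p) (X $ p $ j))"
        by (simp add: d_def sum_distrib_left pure_mult eval_form_sum)
      also have "\<dots> = (\<Sum>p\<in>UNIV. \<Sum>l\<in>UNIV. \<beta> (X $ i $ l * W $ l $ p) (X $ p $ j))"
        by (rule sum.swap)
      also have "\<dots> = (\<Sum>p\<in>UNIV. \<beta> (if i = p then 1 else 0) (X $ p $ j))"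
        by (simp add: XW' flip: balancedD(6)[OF \<beta>])
      also have "\<dots> = (\<Sum>p\<in>UNIV. if i = p then \<beta> 1 (X $ p $ j) else 0)"
        by (intro sum.cong) (auto simp: balancedD(4)[OF \<beta>])
      also have "\<dots> = \<beta> 1 (X $ i $ j)" by simp
      finally show "eval_form \<beta> (1 \<otimes> X $ i $ j - (\<Sum>l\<in>UNIV. X $ i $ l \<otimes> 1 * d l)) = 0"
        by (simp add: eval_form_diff)
    qed
  qed
qed

text \<open>The one-dimensional analogue: \<open>u \<otimes> inverse u\<close> is constant, since
  \<open>a\<close> crosses the tensor sign and cancels there.\<close>

lemma pure_right_inverse:
  assumes "u \<in> R" "inverse u \<in> R" "u \<noteq> 0" and \<sigma>u: "\<sigma> u = a * u" and "a \<in> F"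
  shows "1 \<otimes> inverse u \<in> left_span const_tensors"
proof (rule left_span_cong)
  have "\<sigma> u * \<sigma> (inverse u) = 1"
    using \<open>u \<noteq> 0\<close> hom_1 by (simp flip: hom_mult)
  then have a: "a * \<sigma> (inverse u) = inverse u"
    using \<open>u \<noteq> 0\<close> by (simp add: \<sigma>u field_simps)
  have "u \<otimes> inverse u \<in> const_tensors"
    unfolding const_tensors_def
  proof (intro CollectI conjI nullI)
    show "u \<otimes> inverse u \<in> tensor_support R"
      using assms by (intro tensor_support_pure)
    fix \<beta> assume \<beta>: "\<beta> \<in> balanced F"
    show "eval_form \<beta> (tensor_map \<sigma> (u \<otimes> inverse u) - u \<otimes> inverse u) = 0"
      using balancedD(3)[OF \<beta> \<open>a \<in> F\<close>] by (simp add: eval_form_diff \<sigma>u a)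
  qed
  then show "inverse u \<otimes> 1 * u \<otimes> inverse u \<in> left_span const_tensors"
    using assms by (intro left_span.gen)
  show "1 \<otimes> inverse u - inverse u \<otimes> 1 * u \<otimes> inverse u \<in> null"
    using \<open>u \<noteq> 0\<close> by (simp add: pure_mult vanishing_0)
qed

end

text \<open>Distinct permutations give distinct monomials in the Leibniz expansion, so the generic
  determinant is a nonzero polynomial over \<open>K\<close>. If \<open>det X\<close> vanished, it
  would be an algebraic relation between the indeterminates.\<close>

lemma differential_indeterminates_det_nonzero:
  fixes X :: "'a::field_char_0^'m^'m"
  assumes "differential_indeterminates \<delta> K X" and K: "is_subring K"
  shows "det X \<noteq> 0"
proof
  assume "det X = 0"
  define x where "x = (\<lambda>(i, j, n). (\<delta> ^^ n) (X $ i $ j))"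
  let ?P = "{\<pi>. \<pi> permutes (UNIV :: 'm set)}"
  \<comment> \<open>The exponent vector of the product of the \<open>X $ i $ \<pi> i\<close>; the
    index \<open>0\<close> is the order of differentiation.\<close>
  define mono where "mono \<pi> = (\<Sum>i\<in>UNIV. Poly_Mapping.single (i, \<pi> i, 0 :: nat) (1 :: nat))" for \<pi> :: "'m \<Rightarrow> 'm"
  have lookup_mono: "Poly_Mapping.lookup (mono \<pi>) v = (if v \<in> range (\<lambda>i. (i, \<pi> i, 0)) then 1 else 0)" for \<pi> v
  proof -
    obtain i j n where v: "v = (i, j, n)" by (cases v)
    have "Poly_Mapping.lookup (mono \<pi>) v = (\<Sum>l\<in>UNIV. if l = i then (if j = \<pi> i \<and> n = 0 then 1 else 0) else 0)"
      unfolding mono_def lookup_sum v lookup_single when_def by (intro sum.cong) auto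
    also have "\<dots> = (if v \<in> range (\<lambda>i. (i, \<pi> i, 0)) then 1 else 0)"
      by (auto simp: v)
    finally show ?thesis .
  qed
  have keys_mono: "Poly_Mapping.keys (mono \<pi>) = range (\<lambda>i. (i, \<pi> i, 0))" for \<pi>
    by (rule set_eqI) (simp add: in_keys_iff lookup_mono)
  have inj: "inj mono"
  proof
    fix \<pi> \<rho> assume "mono \<pi> = mono \<rho>"
    then have eq: "range (\<lambda>i. (i, \<pi> i, 0 :: nat)) = range (\<lambda>i. (i, \<rho> i, 0 :: nat))"
      by (metis keys_mono)
    show "\<pi> = \<rho>"
    proof
      fix i
      have "(i, \<pi> i, 0 :: nat) \<in> range (\<lambda>i. (i, \<rho> i, 0 :: nat))" using eq by blast
      then show "\<pi> i = \<rho> i" by auto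
    qed
  qed
  define p where "p = (\<Sum>\<pi>\<in>?P. Poly_Mapping.single (mono \<pi>) (of_int (sign \<pi>) :: 'a))"
  have fin: "finite ?P" by (rule finite_permutations) simp
  have lookup_p: "Poly_Mapping.lookup p (mono \<pi>) = of_int (sign \<pi>)" if "\<pi> \<in> ?P" for \<pi>
  proof -
    have "Poly_Mapping.lookup p (mono \<pi>) = (\<Sum>\<rho>\<in>?P. if \<rho> = \<pi> then of_int (sign \<rho>) else 0)"
      unfolding p_def lookup_sum lookup_single when_def using inj by (intro sum.cong) (auto simp: inj_eq)
    then show ?thesis using fin that by simp
  qed
  have lookup_p_0: "Poly_Mapping.lookup p t = 0" if "t \<notin> mono ` ?P" for t
    unfolding p_def lookup_sum lookup_single when_def using that by (intro sum.neutral) auto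
  have keys_p: "Poly_Mapping.keys p \<subseteq> mono ` ?P"
    using lookup_p_0 by (auto simp: in_keys_iff)
  have sign_K: "of_int (sign \<pi>) \<in> K" for \<pi> :: "'m \<Rightarrow> 'm"
    using is_subringD[OF K] by (auto simp: sign_def)
  have "Poly_Mapping.lookup p t \<in> K" for t
    using lookup_p lookup_p_0 sign_K is_subringD(1)[OF K] by (cases "t \<in> mono ` ?P") auto
  moreover have "mpoly_eval x p = 0"
  proof -
    have "mpoly_eval x p = (\<Sum>t\<in>mono ` ?P. Poly_Mapping.lookup p t *
        (\<Prod>v\<in>Poly_Mapping.keys t. x v ^ Poly_Mapping.lookup t v))"
      unfolding mpoly_eval_def using fin keys_p by (intro sum.mono_neutral_left) (auto simp: in_keys_iff)
    also have "\<dots> = (\<Sum>\<pi>\<in>?P. Poly_Mapping.lookup p (mono \<pi>) *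
        (\<Prod>v\<in>Poly_Mapping.keys (mono \<pi>). x v ^ Poly_Mapping.lookup (mono \<pi>) v))"
      by (simp add: sum.reindex[OF inj_on_subset[OF inj subset_UNIV]])
    also have "\<dots> = (\<Sum>\<pi>\<in>?P. of_int (sign \<pi>) * (\<Prod>i\<in>UNIV. X $ i $ \<pi> i))"
    proof (intro sum.cong refl arg_cong2[of _ _ _ _ "(*)"])
      fix \<pi> assume "\<pi> \<in> ?P"
      then show "Poly_Mapping.lookup p (mono \<pi>) = of_int (sign \<pi>)" by (rule lookup_p)
      have "(\<Prod>v\<in>Poly_Mapping.keys (mono \<pi>). x v ^ Poly_Mapping.lookup (mono \<pi>) v)
          = (\<Prod>v\<in>range (\<lambda>i. (i, \<pi> i, 0)). x v)"
        unfolding keys_mono by (intro prod.cong) (auto simp: lookup_mono)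
      also have "\<dots> = (\<Prod>i\<in>UNIV. X $ i $ \<pi> i)"
        by (subst prod.reindex) (auto simp: inj_on_def x_def)
      finally show "(\<Prod>v\<in>Poly_Mapping.keys (mono \<pi>). x v ^ Poly_Mapping.lookup (mono \<pi>) v)
          = (\<Prod>i\<in>UNIV. X $ i $ \<pi> i)" .
    qed
    also have "\<dots> = det X" by (simp add: det_def)
    finally show ?thesis using \<open>det X = 0\<close> by simp
  qed
  ultimately have "p = 0"
    using assms(1) unfolding differential_indeterminates_def alg_independent_over_def x_def by blast
  then have "Poly_Mapping.lookup p (mono id) = 0" by simp
  moreover have "Poly_Mapping.lookup p (mono id) = 1"
    using lookup_p[of id] by (simp add: permutes_id sign_id)
  ultimately show False by simp
qed

subsection \<open>The Picard-Vessiot extension\<close>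

text \<open>A bijection of the ambient field mapping \<open>R\<close> into itself need not map onto
  \<open>R\<close>; stability under the inverse ensures this.\<close>

lemma automorphism_ofI:
  fixes R :: "'a::field set"
  assumes "bij \<sigma>" "\<sigma> 1 = 1" "\<And>x y. \<sigma> (x + y) = \<sigma> x + \<sigma> y" "\<And>x y. \<sigma> (x * y) = \<sigma> x * \<sigma> y"
    and "\<sigma> ` R \<subseteq> R" "inv \<sigma> ` R \<subseteq> R"
  shows "automorphism_of R \<sigma>"
proof -
  have "R \<subseteq> \<sigma> ` R"
  proof
    fix x assume "x \<in> R"
    then have "inv \<sigma> x \<in> R" "x = \<sigma> (inv \<sigma> x)"
      using assms by (auto simp: bij_is_surj surj_f_inv_f)
    then show "x \<in> \<sigma> ` R" by blast
  qed
  then have "bij_betw \<sigma> R R"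
    using assms(1,5) by (auto simp: bij_betw_def bij_def intro: inj_on_subset)
  then show ?thesis
    using assms by (simp add: automorphism_of_def)
qed

theorem proposition2p1:
  fixes \<sigma> \<delta> :: "'l::field_char_0 \<Rightarrow> 'l"
    and k :: "'l set"
    and A X :: "'l^'m^'m"
  defines "L \<equiv> (UNIV :: 'l set)"
  defines "kC\<^sub>L \<equiv> is_subfield hull (k \<union> sigma_constants \<sigma> L)"
  assumes k: "sigma_delta_field \<sigma> \<delta> k"
    and A: "A \<in> GL_over k"
    and L: "sigma_delta_field \<sigma> \<delta> L"
    and X_indet: "differential_indeterminates \<delta> k X"
    and L_gen: "L = delta_field_gen \<delta> k (mat_entries X \<union> {inverse (det X)})"
    and sigma_X: "map_matrix \<sigma> X = A ** X"
    and D_k: "rel_alg_closure_constants \<sigma> k = sigma_constants \<sigma> k"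
  shows "picard_vessiot_extension \<sigma> \<delta> kC\<^sub>L A
           (delta_ring_gen \<delta> kC\<^sub>L (mat_entries X \<union> {inverse (det X)})) \<and>
         simple_sigma_ring \<sigma> (delta_ring_gen \<delta> kC\<^sub>L (mat_entries X \<union> {inverse (det X)}))"
proof -
  define P where "P = delta_ring_gen \<delta> kC\<^sub>L (mat_entries X \<union> {inverse (det X)})"

  \<comment> \<open>The operators on the ambient field\<close>
  have \<sigma>: "bij \<sigma>" "\<sigma> 1 = 1" "\<sigma> (x + y) = \<sigma> x + \<sigma> y" "\<sigma> (x * y) = \<sigma> x * \<sigma> y"
    and \<delta>_add: "\<delta> (x + y) = \<delta> x + \<delta> y" and \<delta>_mult: "\<delta> (x * y) = \<delta> x * y + x * \<delta> y"
    and comm: "\<sigma> (\<delta> x) = \<delta> (\<sigma> x)" for x y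
    using L unfolding L_def sigma_delta_field_def sigma_delta_ring_def automorphism_of_def derivation_of_def
    by auto
  define \<tau> where "\<tau> = inv \<sigma>"
  have \<tau>\<sigma>: "\<tau> (\<sigma> x) = x" and \<sigma>\<tau>: "\<sigma> (\<tau> x) = x" for x
    using \<sigma>(1) by (simp_all add: \<tau>_def bij_is_inj bij_is_surj inv_f_f surj_f_inv_f)
  interpret \<sigma>: field_endomorphism \<sigma> by unfold_locales (fact \<sigma>)+
  interpret \<tau>: field_endomorphism \<tau>
  proof
    show "\<tau> (x + y) = \<tau> x + \<tau> y" for x y using \<tau>\<sigma>[of "\<tau> x + \<tau> y"] by (simp add: \<sigma> \<sigma>\<tau>)
    show "\<tau> (x * y) = \<tau> x * \<tau> y" for x y using \<tau>\<sigma>[of "\<tau> x * \<tau> y"] by (simp add: \<sigma> \<sigma>\<tau>)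
    show "\<tau> 1 = 1" using \<tau>\<sigma>[of 1] by (simp add: \<sigma>)
  qed
  have comm': "\<tau> (\<delta> x) = \<delta> (\<tau> x)" for x
    using \<tau>\<sigma>[of "\<delta> (\<tau> x)"] by (simp add: comm \<sigma>\<tau>)
  have \<delta>_0: "\<delta> 0 = 0" using \<delta>_add[of 0 0] by (metis add.right_neutral add_left_imp_eq)
  have \<delta>_1: "\<delta> 1 = 0"
    using \<delta>_mult[of 1 1] by (metis add.right_neutral add_left_imp_eq mult.left_neutral mult.right_neutral)
  have \<delta>_uminus: "\<delta> (- x) = - \<delta> x" for x
    using \<delta>_add[of x "- x"] \<delta>_0 by (simp add: eq_neg_iff_add_eq_0 add.commute)
  have \<delta>_inverse: "\<delta> (inverse x) = - (\<delta> x * inverse x * inverse x)" for x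
  proof (cases "x = 0")
    case False
    then have "\<delta> x * inverse x + x * \<delta> (inverse x) = 0"
      using \<delta>_mult[of x "inverse x"] \<delta>_1 by simp
    then have "x * \<delta> (inverse x) = - (\<delta> x * inverse x)"
      by (simp add: eq_neg_iff_add_eq_0 add.commute)
    moreover have "\<delta> (inverse x) = inverse x * (x * \<delta> (inverse x))"
      using False by simp
    ultimately show ?thesis by (simp add: mult_ac)
  qed (simp add: \<delta>_0)

  \<comment> \<open>The field \<open>kC\<^sub>L\<close> and its operators\<close>
  have k_field: "is_subfield k" and k_ring: "is_subring k"
    and \<sigma>_k: "\<sigma> ` k = k" and \<delta>_k: "\<delta> ` k \<subseteq> k"
    using k by (auto simp: sigma_delta_field_def sigma_delta_ring_def automorphism_of_def
      derivation_of_def bij_betw_def)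
  have \<tau>_k: "\<tau> x \<in> k" if "x \<in> k" for x
    using that \<sigma>_k \<tau>\<sigma> by (metis imageE)

  have F_field: "is_subfield kC\<^sub>L"
    unfolding kC\<^sub>L_def by (rule hull_in) (rule is_subfield_Inter, blast)
  then have F_ring: "is_subring kC\<^sub>L" by (simp add: is_subfield_def)
  have kF: "k \<subseteq> kC\<^sub>L" and CF: "\<sigma> x = x \<Longrightarrow> x \<in> kC\<^sub>L" for x
    using hull_subset[of "k \<union> sigma_constants \<sigma> L" is_subfield]
    by (auto simp: kC\<^sub>L_def sigma_constants_def L_def)
  have F_minimal: "kC\<^sub>L \<subseteq> G" if "is_subfield G" "k \<subseteq> G" "\<And>x. \<sigma> x = x \<Longrightarrow> x \<in> G" for G
    unfolding kC\<^sub>L_def by (rule hull_minimal) (use that in \<open>auto simp: sigma_constants_def\<close>)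
  \<comment> \<open>The preimage of the field is a subfield containing \<open>k\<close> and the
    constants, so minimality gives stability.\<close>
  have "kC\<^sub>L \<subseteq> {x. \<sigma> x \<in> kC\<^sub>L}"
    using \<sigma>_k kF CF by (intro F_minimal \<sigma>.is_subfield_vimage F_field) auto
  then have \<sigma>_F: "\<sigma> ` kC\<^sub>L \<subseteq> kC\<^sub>L" by auto
  have "kC\<^sub>L \<subseteq> {x. \<tau> x \<in> kC\<^sub>L}"
  proof (intro F_minimal \<tau>.is_subfield_vimage F_field)
    show "x \<in> {x. \<tau> x \<in> kC\<^sub>L}" if "\<sigma> x = x" for x
      using \<tau>\<sigma>[of x] CF[OF that] that by simp
  qed (use \<tau>_k kF in auto)
  then have \<tau>_F: "\<tau> ` kC\<^sub>L \<subseteq> kC\<^sub>L" by auto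
  have "kC\<^sub>L \<subseteq> {x \<in> kC\<^sub>L. \<delta> x \<in> kC\<^sub>L}"
  proof (rule F_minimal)
    note F_simps = is_subringD[OF F_ring] \<delta>_0 \<delta>_1 \<delta>_add \<delta>_mult \<delta>_uminus \<delta>_inverse
    show "is_subfield {x \<in> kC\<^sub>L. \<delta> x \<in> kC\<^sub>L}"
    proof (rule is_subfieldI)
      show "is_subring {x \<in> kC\<^sub>L. \<delta> x \<in> kC\<^sub>L}"
        unfolding is_subring_def by (simp add: F_simps)
      show "inverse x \<in> {x \<in> kC\<^sub>L. \<delta> x \<in> kC\<^sub>L}" if "x \<in> {x \<in> kC\<^sub>L. \<delta> x \<in> kC\<^sub>L}" for x
        using that by (simp add: F_simps is_subfield_inverse[OF F_field])
    qed
    \<comment> \<open>The element \<open>\<delta> x\<close> is again a constant because the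
      operators commute.\<close>
    show "x \<in> {x \<in> kC\<^sub>L. \<delta> x \<in> kC\<^sub>L}" if "\<sigma> x = x" for x
      using CF[OF that] CF[of "\<delta> x"] comm[of x] that by simp
  qed (use \<delta>_k kF in auto)
  then have \<delta>_F: "\<delta> ` kC\<^sub>L \<subseteq> kC\<^sub>L" by auto

  \<comment> \<open>The ring \<open>P\<close> and its fundamental matrix\<close>
  note P_props = delta_ring_gen_props[where \<delta> = \<delta> and F = "kC\<^sub>L"
      and S = "mat_entries X \<union> {inverse (det X)}", folded P_def]
  have P_ring: "is_subring P" and \<delta>_P: "\<delta> ` P \<subseteq> P" and FP: "kC\<^sub>L \<subseteq> P" by (fact P_props)+
  have X_P: "X $ i $ j \<in> P" for i j
    using P_props(4) by (auto simp: mat_entries_def)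
  have det_P: "det X \<in> P" "inverse (det X) \<in> P"
    using P_props(4) X_P is_subring_det[OF P_ring] by auto

  have det_X: "det X \<noteq> 0"
    by (rule differential_indeterminates_det_nonzero[OF X_indet k_ring])
  obtain B where "mat_entries A \<subseteq> k" "mat_entries B \<subseteq> k"
    and AB: "A ** B = mat 1" "B ** A = mat 1"
    using A by (auto simp: GL_over_def)
  then have A_k: "A $ i $ j \<in> k" and B_k: "B $ i $ j \<in> k" for i j
    by (auto simp: mat_entries_def)
  obtain W where XW: "X ** W = mat 1" "W ** X = mat 1"
    using det_X invertible_det_nz[of X] by (auto simp: invertible_def)
  have W_P: "W $ i $ j \<in> P" for i j
    by (rule is_subring_matrix_inverse[OF P_ring X_P det_P(2) XW(1)])
  have \<sigma>_det: "\<sigma> (det X) = det A * det X"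
    by (simp add: \<sigma>.hom_det sigma_X det_mul)
  have det_A: "det A \<in> kC\<^sub>L"
    using is_subring_det[OF k_ring A_k] kF by auto
  have det_A_nz: "det A \<noteq> 0"
    using AB(1) by (metis det_I det_mul mult_zero_left zero_neq_one)

  have "A ** X ** map_matrix \<sigma> W = mat 1"
    using \<sigma>.hom_matrix_mult[of X W] by (simp add: XW \<sigma>.hom_mat_1 sigma_X)
  \<comment> \<open>\<open>W ** B\<close> is the inverse of \<open>A ** X\<close>, so multiplying by
    it isolates \<open>map_matrix \<sigma> W\<close>.\<close>
  then have "W ** B ** (A ** X ** map_matrix \<sigma> W) = W ** B" by simp
  moreover have "W ** B ** (A ** X ** map_matrix \<sigma> W) = W ** (B ** A) ** X ** map_matrix \<sigma> W"
    by (simp add: matrix_mul_assoc)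
  ultimately have "map_matrix \<sigma> W = W ** B"
    using AB XW by (simp add: matrix_mul_assoc)
  then have \<sigma>_W: "map_matrix \<sigma> W ** A = W"
    by (simp add: AB flip: matrix_mul_assoc)

  have "\<sigma> ` (mat_entries X \<union> {inverse (det X)}) \<subseteq> P"
  proof -
    have "map_matrix \<sigma> X $ i $ j \<in> P" for i j
      unfolding sigma_X using A_k kF FP X_P by (intro is_subring_matrix_mult[OF P_ring]) auto
    then have "\<sigma> (X $ i $ j) \<in> P" for i j
      by (simp add: map_matrix_def)
    moreover have "\<sigma> (inverse (det X)) \<in> P"
      using is_subfield_inverse[OF F_field det_A] FP det_P(2) is_subringD(4)[OF P_ring]
      by (auto simp: \<sigma>.hom_inverse \<sigma>_det)
    ultimately show ?thesis
      by (auto simp: mat_entries_def)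
  qed
  then have \<sigma>_P: "\<sigma> ` P \<subseteq> P"
    unfolding P_def by (rule \<sigma>.delta_ring_gen_stable[where \<delta> = \<delta>, OF comm \<sigma>_F])
  \<comment> \<open>Applying \<open>\<tau>\<close> to \<open>B ** map_matrix \<sigma> X = X\<close>
    gives the equation of \<open>X\<close> for the inverse operator.\<close>
  have "map_matrix \<tau> (map_matrix \<sigma> X) = X"
    by (simp add: map_matrix_def \<tau>\<sigma> vec_eq_iff)
  then have \<tau>_X: "map_matrix \<tau> X = map_matrix \<tau> B ** X"
    using \<tau>.hom_matrix_mult[of B "map_matrix \<sigma> X"] by (simp add: sigma_X AB matrix_mul_assoc)
  have \<tau>_det: "\<tau> (inverse (det X)) = \<tau> (det A) * inverse (det X)"
  proof -
    have "inverse (det X) = det A * \<sigma> (inverse (det X))"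
      using det_A_nz by (simp add: \<sigma>.hom_inverse \<sigma>_det)
    then show ?thesis by (metis \<tau>.hom_mult \<tau>\<sigma>)
  qed
  have "\<tau> ` (mat_entries X \<union> {inverse (det X)}) \<subseteq> P"
  proof -
    have "map_matrix \<tau> X $ i $ j \<in> P" for i j
      unfolding \<tau>_X using B_k[THEN \<tau>_k] kF FP X_P
      by (intro is_subring_matrix_mult[OF P_ring]) (auto simp: map_matrix_def)
    then have "\<tau> (X $ i $ j) \<in> P" for i j
      by (simp add: map_matrix_def)
    moreover have "\<tau> (inverse (det X)) \<in> P"
      using \<tau>_F det_A FP det_P(2) is_subringD(4)[OF P_ring] by (auto simp: \<tau>_det)
    ultimately show ?thesis
      by (auto simp: mat_entries_def)
  qed
  then have \<tau>_P: "\<tau> ` P \<subseteq> P"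
    unfolding P_def by (rule \<tau>.delta_ring_gen_stable[where \<delta> = \<delta>, OF comm' \<tau>_F])
  have aut: "automorphism_of S \<sigma>" if "\<sigma> ` S \<subseteq> S" "\<tau> ` S \<subseteq> S" for S
    using that \<sigma> by (intro automorphism_ofI) (auto simp: \<tau>_def)
  have deriv: "derivation_of S \<delta>" if "\<delta> ` S \<subseteq> S" for S
    using that \<delta>_add \<delta>_mult by (simp add: derivation_of_def)

  \<comment> \<open>Simplicity of \<open>P\<close>\<close>
  interpret difference_tensor \<sigma> "kC\<^sub>L" P
    by unfold_locales (fact F_field P_ring FP \<sigma>_F CF)+
  \<comment> \<open>\<open>E\<close> will be a \<open>\<delta>\<close>-stable subring containing the
    generators of \<open>P\<close>, hence all of \<open>P\<close>; this is the equality
    \<open>P \<otimes> P = (P \<otimes> 1) D\<close>.\<close>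
  define E where "E = {r \<in> P. 1 \<otimes> r \<in> left_span const_tensors}"
  have "P \<subseteq> E"
    unfolding P_def
  proof (rule delta_ring_gen_minimal)
    show "is_subring E"
      unfolding E_def by (rule pure_right_subring)
    show "\<delta> ` E \<subseteq> E"
      using \<delta>_P pure_right_deriv[where \<delta> = \<delta>, OF \<delta>_add \<delta>_mult comm \<delta>_F \<delta>_P] by (auto simp: E_def)
    show "kC\<^sub>L \<subseteq> E"
      using FP pure_right_F by (auto simp: E_def)
    have "A $ i $ j \<in> kC\<^sub>L" for i j
      using A_k kF by auto
    then have "X $ i $ j \<in> E" for i j
      using pure_right_matrix[OF X_P W_P _ XW(1) sigma_X \<sigma>_W] X_P by (simp add: E_def)
    moreover have "inverse (det X) \<in> E"
      using pure_right_inverse[OF det_P det_X \<sigma>_det det_A] det_P by (simp add: E_def)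
    ultimately show "mat_entries X \<union> {inverse (det X)} \<subseteq> E"
      by (auto simp: mat_entries_def)
  qed
  \<comment> \<open>A \<open>\<sigma>\<delta>\<close>-ideal is in particular a
    \<open>\<sigma>\<close>-ideal, so this dichotomy gives both simplicity claims.\<close>
  then have simple: "I = {0} \<or> I = P" if I: "ideal_of P I" "\<sigma> ` I \<subseteq> I" for I
  proof (cases "\<exists>h\<in>I. h \<noteq> 0")
    case True
    then have "1 \<in> I"
      using nonzero_ideal_contains_1[OF I] \<open>P \<subseteq> E\<close> by (auto simp: E_def)
    then have "x \<in> I" if "x \<in> P" for x
      using ideal_mult[OF I that] by fastforce
    then show ?thesis using I by (auto simp: ideal_of_def)
  qed (use I in \<open>auto simp: ideal_of_def\<close>)

  have "sigma_delta_ring \<sigma> \<delta> P" and "sigma_delta_field \<sigma> \<delta> kC\<^sub>L"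
    using aut deriv comm F_field F_ring P_ring \<sigma>_F \<tau>_F \<delta>_F \<delta>_P \<sigma>_P \<tau>_P
    by (auto simp: sigma_delta_ring_def sigma_delta_field_def)
  moreover have "A \<in> GL_over kC\<^sub>L"
    using A kF unfolding GL_over_def by blast
  moreover have "X \<in> GL_over P"
    using X_P W_P XW unfolding GL_over_def mat_entries_def by blast
  ultimately have "picard_vessiot_extension \<sigma> \<delta> kC\<^sub>L A P" "simple_sigma_ring \<sigma> P"
    using simple FP sigma_X det_X det_P P_def
    by (auto simp: picard_vessiot_extension_def simple_sigma_delta_ring_def simple_sigma_ring_def
        sigma_ring_def sigma_delta_ring_def intro!: bexI[of _ X] bexI[of _ "inverse (det X)"])
  then show ?thesis by (simp add: P_def)
qed

end
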